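(* Let $q$ be a meromorphic quadratic differential with at worst simple poles on a closed Riemann surface $X$, and assume that $\Lambda(q)$ is a lattice in $G=\mathrm{SL}(2,\mathbf{R})$. Let $c<\infty$ be the constant such that for all $g\in G$ $$\lim_{R\to\infty}\frac{N(q(g),R)}{R^2}=c\pi .$$ If $\psi\in C_c(\mathbf{R}^2)$, then $$\lim_{R\to\infty}\frac1{R^2}\sum_{v\in\Pi(q)}\psi\left(\frac vR\right)=c\int_{\mathbf{R}^2}\psi(u)\,du .$$
   Context: For a countable set of directions $\theta$ the horizontal foliation associated to $e^{-2i\theta}q$ has one or more maximal cylinders of closed leaves. Each cylinder determines a pair of vectors $v=\pm re^{i\theta}$, where $r$ is the common $|q|$-length of the closed leaves in the cylinder. $\Pi(q)\subset\mathbf{C}=\mathbf{R}^2$ is the set of vectors, with multiplicities, which arise from such cylinders as $\theta$ varies (each cylinder contributing one pair $\pm v$), and $N(q,R)=\mathrm{Card}\{v\in\Pi(q)\mid|v|<R\}$. Let $\mathcal{U}_q$ be the atlas of natural parameters for $q$ on $X\setminus q^{-1}\{0,\infty\}$ (charts in which $q=dz^2$). If $g\in G$, the atlas $g\,\mathcal{U}_q$ is defined by postcomposing the $\mathcal{U}_q$ chart functions with the $\mathbf{R}$-linear transformation $g$ of $\mathbf{R}^2$; it extends to $X$ as a complex structure and determines a new quadratic differential with the same pattern of zeros and poles as $q$. The new pair is denoted $(X(g),q(g))$. Define $\Lambda(q)=\{g\in G\mid(X,q)\cong(X(g),q(g))\}$, where $\cong$ means biholomorphism identifying $q$ and $q(g)$;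 it is a discrete subgroup of $G$. It is a known theorem that when $\Lambda(q)$ is a lattice a constant $c<\infty$ as in the claim exists. *)

theory Defs
  imports "HOL-Complex_Analysis.Complex_Analysis" "HOL-Algebra.Left_Coset"
begin

section \<open>Riemann surfaces\<close>

text \<open>
  A chart is a pair of a domain and a coordinate function; the values of the coordinate function
  outside the domain are irrelevant.
\<close>

type_synonym 'a chart = "'a set \<times> ('a \<Rightarrow> complex)"

definition is_chart :: "'a topology \<Rightarrow> 'a chart \<Rightarrow> bool" where
  "is_chart T = (\<lambda>(U, \<phi>). openin T U \<and> open (\<phi> ` U) \<and>
     homeomorphic_map (subtopology T U) (top_of_set (\<phi> ` U)) \<phi>)"

definition transition :: "'a chart \<Rightarrow> 'a chart \<Rightarrow> complex \<Rightarrow> complex" where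
  "transition = (\<lambda>(U, \<phi>) (V, \<psi>). \<psi> \<circ> inv_into U \<phi>)"

definition compatible :: "'a chart \<Rightarrow> 'a chart \<Rightarrow> bool" where
  "compatible = (\<lambda>(U, \<phi>) (V, \<psi>).
     transition (U, \<phi>) (V, \<psi>) holomorphic_on \<phi> ` (U \<inter> V) \<and>
     transition (V, \<psi>) (U, \<phi>) holomorphic_on \<psi> ` (U \<inter> V))"

text \<open>A complex structure is given by its maximal holomorphic atlas.\<close>

definition complex_structure :: "'a topology \<Rightarrow> 'a chart set \<Rightarrow> bool" where
  "complex_structure T A \<longleftrightarrow>
     (\<forall>c\<in>A. is_chart T c) \<and> (\<Union>c\<in>A. fst c) = topspace T \<and>
     (\<forall>c\<in>A. \<forall>d\<in>A. compatible c d) \<and>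
     (\<forall>c. is_chart T c \<and> (\<forall>d\<in>A. compatible c d) \<longrightarrow> c \<in> A)"

definition closed_riemann_surface :: "'a topology \<Rightarrow> 'a chart set \<Rightarrow> bool" where
  "closed_riemann_surface T A \<longleftrightarrow>
     topspace T \<noteq> {} \<and> connected_space T \<and> Hausdorff_space T \<and> compact_space T \<and>
     complex_structure T A"


section \<open>Quadratic differentials\<close>

text \<open>
  A pair \<open>(X, q)\<close>. In a chart \<open>(U, \<phi>)\<close> one has \<open>q = f(p) d\<phi>\<^sup>2\<close> at
  \<open>p \<in> U\<close>, where \<open>f = qcoeff S (U, \<phi>)\<close>.
\<close>

record 'a quad_surface =
  qtop :: "'a topology"
  qatlas :: "'a chart set"
  qcoeff :: "'a chart \<Rightarrow> 'a \<Rightarrow> complex"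

text \<open>
  The coefficients are nicely meromorphic, i.e. removable singularities are removed and the value
  at a pole is 0. With this convention the transformation rule also holds at the poles (both sides
  being 0), and the coefficient vanishes exactly on \<open>q\<^sup>-\<^sup>1{0, \<infinity>}\<close>.
  As usual, the differential that vanishes identically is excluded.
\<close>

definition closed_quad_surface :: "'a quad_surface \<Rightarrow> bool" where
  "closed_quad_surface S \<longleftrightarrow>
     closed_riemann_surface (qtop S) (qatlas S) \<and>
     (\<forall>(U, \<phi>)\<in>qatlas S.
        (qcoeff S (U, \<phi>) \<circ> inv_into U \<phi>) nicely_meromorphic_on \<phi> ` U \<and>
        (\<forall>z\<in>\<phi> ` U. is_pole (qcoeff S (U, \<phi>) \<circ> inv_into U \<phi>) z \<longrightarrow>
           zorder (qcoeff S (U, \<phi>) \<circ> inv_into U \<phi>) z = -1)) \<and>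
     (\<forall>(U, \<phi>)\<in>qatlas S. \<forall>(V, \<psi>)\<in>qatlas S. \<forall>p\<in>U \<inter> V.
        qcoeff S (U, \<phi>) p =
          qcoeff S (V, \<psi>) p * (deriv (transition (U, \<phi>) (V, \<psi>)) (\<phi> p))\<^sup>2) \<and>
     (\<exists>(U, \<phi>)\<in>qatlas S. \<exists>p\<in>U. qcoeff S (U, \<phi>) p \<noteq> 0)"

text \<open>
  The atlas of natural parameters, i.e. of charts in which \<open>q = dz\<^sup>2\<close>. Their domains cover
  precisely the complement of \<open>q\<^sup>-\<^sup>1{0, \<infinity>}\<close>.
\<close>

definition natural_parameters :: "'a quad_surface \<Rightarrow> 'a chart set" where
  "natural_parameters S = {(U, u) \<in> qatlas S. \<forall>p\<in>U. qcoeff S (U, u) p = 1}"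

text \<open>\<open>(X, q) \<cong> (X', q')\<close>: a biholomorphic map \<open>F\<close> with \<open>F\<^sup>*q' = q\<close>.\<close>

definition holomorphic_map :: "'a quad_surface \<Rightarrow> 'b quad_surface \<Rightarrow> ('a \<Rightarrow> 'b) \<Rightarrow> bool" where
  "holomorphic_map S S' F \<longleftrightarrow>
     continuous_map (qtop S) (qtop S') F \<and>
     (\<forall>(U, \<phi>)\<in>qatlas S. \<forall>(V, \<psi>)\<in>qatlas S'.
        (\<psi> \<circ> F \<circ> inv_into U \<phi>) holomorphic_on \<phi> ` {p \<in> U. F p \<in> V})"

definition isomorphic_quad :: "'a quad_surface \<Rightarrow> 'b quad_surface \<Rightarrow> bool" where
  "isomorphic_quad S S' \<longleftrightarrow>
     (\<exists>F F'. homeomorphic_maps (qtop S) (qtop S') F F' \<and>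
        holomorphic_map S S' F \<and> holomorphic_map S' S F' \<and>
        (\<forall>(U, \<phi>)\<in>qatlas S. \<forall>(V, \<psi>)\<in>qatlas S'. \<forall>p\<in>U. F p \<in> V \<longrightarrow>
           qcoeff S (U, \<phi>) p =
             qcoeff S' (V, \<psi>) (F p) * (deriv (\<psi> \<circ> F \<circ> inv_into U \<phi>) (\<phi> p))\<^sup>2))"


section \<open>The action of \<open>SL(2,\<real>)\<close>\<close>

definition SL2R :: "(real^2^2) monoid" where
  "SL2R = \<lparr>carrier = {g. det g = 1}, mult = (**), one = mat 1\<rparr>"

definition mat_act :: "real^2^2 \<Rightarrow> complex \<Rightarrow> complex" where
  "mat_act g z = Complex (g $ 1 $ 1 * Re z + g $ 1 $ 2 * Im z) (g $ 2 $ 1 * Re z + g $ 2 $ 2 * Im z)"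

definition act_natural :: "real^2^2 \<Rightarrow> 'a quad_surface \<Rightarrow> 'a chart set" where
  "act_natural g S = (\<lambda>(W, u). (W, mat_act g \<circ> u)) ` natural_parameters S"

text \<open>
  \<open>(X(g), q(g))\<close>. The charts of \<open>X(g)\<close> are all topological charts of \<open>X\<close>, possibly around
  points of \<open>q\<^sup>-\<^sup>1{0, \<infinity>}\<close>, that are holomorphically compatible with the atlas
  \<open>g \<U>\<^sub>q\<close>; this is the unique extension of that atlas to a complex structure on \<open>X\<close>.
  Away from the singularities \<open>q(g) = d(g \<circ> u)\<^sup>2\<close> for any natural parameter \<open>u\<close> of
  \<open>q\<close> (which is unique up to sign and translation). As \<open>q(g)\<close> has the same zeros and poles
  as \<open>q\<close>, its coefficients are 0 at the singularities of \<open>q\<close>, by the convention for poles.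
\<close>

definition act :: "real^2^2 \<Rightarrow> 'a quad_surface \<Rightarrow> 'a quad_surface" where
  "act g S = \<lparr>qtop = qtop S,
     qatlas = {c. is_chart (qtop S) c \<and> (\<forall>d\<in>act_natural g S. compatible c d)},
     qcoeff = (\<lambda>(U, \<phi>) p.
       if \<exists>d\<in>act_natural g S. p \<in> fst d
       then (deriv (transition (U, \<phi>) (SOME d. d \<in> act_natural g S \<and> p \<in> fst d)) (\<phi> p))\<^sup>2
       else 0)\<rparr>"

definition Lambda :: "'a quad_surface \<Rightarrow> (real^2^2) set" where
  "Lambda S = {g \<in> carrier SL2R. isomorphic_quad S (act g S)}"

text \<open>
  A lattice is a discrete subgroup \<open>\<Gamma>\<close> of \<open>G = SL(2,\<real>)\<close> such that \<open>G/\<Gamma>\<close> carries a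
  nonzero finite \<open>G\<close>-invariant Borel measure. A set \<open>\<U>\<close> of cosets is open in the quotient
  topology iff its preimage \<open>\<Union>\<U>\<close> under \<open>G \<rightarrow> G/\<Gamma>\<close> is open in \<open>G\<close>.
\<close>

definition lattice_SL2R :: "(real^2^2) set \<Rightarrow> bool" where
  "lattice_SL2R \<Gamma> \<longleftrightarrow>
     subgroup \<Gamma> SL2R \<and> discrete \<Gamma> \<and>
     (\<exists>M. space M = lcosets\<^bsub>SL2R\<^esub> \<Gamma> \<and>
        sets M = sigma_sets (lcosets\<^bsub>SL2R\<^esub> \<Gamma>)
          {\<U>. \<U> \<subseteq> lcosets\<^bsub>SL2R\<^esub> \<Gamma> \<and> openin (top_of_set (carrier SL2R)) (\<Union>\<U>)} \<and>
        finite_measure M \<and> emeasure M (space M) \<noteq> 0 \<and>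
        (\<forall>g\<in>carrier SL2R. \<forall>A\<in>sets M. emeasure M ((\<lambda>x. g <#\<^bsub>SL2R\<^esub> x) ` A) = emeasure M A))"


section \<open>Cylinders of closed leaves\<close>

definition rotate_quad :: "real \<Rightarrow> 'a quad_surface \<Rightarrow> 'a quad_surface" where
  "rotate_quad \<theta> S = S\<lparr>qcoeff := (\<lambda>c p. cis (- 2 * \<theta>) * qcoeff S c p)\<rparr>"

text \<open>
  A horizontal trajectory, parametrised by \<open>|q|\<close>-length: near each time it is \<open>s \<mapsto> z\<^sub>0 + s - t\<close>
  in some natural parameter. A closed leaf of length \<open>r\<close> is the image of one with minimal
  period \<open>r\<close>.
\<close>

definition horizontal_trajectory :: "'a quad_surface \<Rightarrow> (real \<Rightarrow> 'a) \<Rightarrow> bool" where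
  "horizontal_trajectory S \<gamma> \<longleftrightarrow>
     (\<forall>t. \<exists>(U, u)\<in>natural_parameters S. \<gamma> t \<in> U \<and>
        (\<forall>\<^sub>F s in nhds t. \<gamma> s \<in> U \<and> u (\<gamma> s) = u (\<gamma> t) + of_real (s - t)))"

definition closed_leaf :: "'a quad_surface \<Rightarrow> 'a set \<Rightarrow> real \<Rightarrow> bool" where
  "closed_leaf S L r \<longleftrightarrow> r > 0 \<and>
     (\<exists>\<gamma>. horizontal_trajectory S \<gamma> \<and> L = range \<gamma> \<and>
        (\<forall>s t. \<gamma> s = \<gamma> t \<longleftrightarrow> (\<exists>k::int. s - t = of_int k * r)))"

text \<open>
  The maximal cylinders are the connected components of the union of all closed leaves. (If \<open>X\<close>
  is a torus and \<open>q\<close> has no singularities, this makes the whole torus a single maximal cylinder.)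
\<close>

definition maximal_cylinder :: "'a quad_surface \<Rightarrow> 'a set \<Rightarrow> real \<Rightarrow> bool" where
  "maximal_cylinder S C r \<longleftrightarrow>
     C \<in> connected_components_of (subtopology (qtop S) (\<Union>{L. \<exists>l. closed_leaf S L l})) \<and>
     {l. \<exists>L\<subseteq>C. closed_leaf S L l} = {r}"

text \<open>
  The set of vectors with multiplicities: a vector \<open>v\<close> occurs once for each cylinder \<open>C\<close>
  giving rise to it. Since \<open>v\<close> determines \<open>\<theta>\<close> modulo \<open>\<pi>\<close>, hence the foliation, each
  cylinder of each foliation contributes exactly the two elements \<open>(C, v)\<close> and \<open>(C, -v)\<close>.
\<close>

definition Pi_vectors :: "'a quad_surface \<Rightarrow> ('a set \<times> complex) set" where
  "Pi_vectors S = {(C, v). \<exists>\<theta> r. maximal_cylinder (rotate_quad \<theta> S) C r \<and>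
     (v = of_real r * cis \<theta> \<or> v = - (of_real r * cis \<theta>))}"

definition ext_card :: "'b set \<Rightarrow> ereal" where
  "ext_card A = (if finite A then ereal (real (card A)) else \<infinity>)"

definition N_count :: "'a quad_surface \<Rightarrow> real \<Rightarrow> ereal" where
  "N_count S R = ext_card {(C, v) \<in> Pi_vectors S. cmod v < R}"

end

theory Submission
  imports Defs "HOL-Probability.Distributions"
begin

text \<open>
  Since \<open>\<Pi>(q(g)) = g \<Pi>(q)\<close>, the hypothesis on \<open>N(q(g), R)\<close> says that \<open>\<Pi>(q)\<close> has
  asymptotically \<open>c R\<^sup>2\<close> times their area many points in the dilates by \<open>R\<close> of every
  ellipse \<open>{v. |g v| < 1}\<close> of area \<open>\<pi>\<close> centred at the origin, that is, that the measures
  \<open>\<mu>\<^sub>R = R\<^sup>-\<^sup>2 \<Sum> \<delta>\<^bsub>v/R\<^esub>\<close> and \<open>c\<close> times Lebesgue measure agree in the limit on these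
  ellipses. This determines the limit on all even functions, and \<open>\<Pi>(q) = - \<Pi>(q)\<close> takes care of
  the odd ones.
  
  The passage from ellipses to even functions goes through Gaussians. A Gaussian \<open>exp (- Q)\<close>, with
  \<open>Q\<close> a positive definite quadratic form, has the form \<open>exp (- l |g v|\<^sup>2)\<close> with \<open>g\<close> in
  \<open>SL(2,\<real>)\<close>; it is a superposition of indicator functions of ellipses of a single shape, and
  integrating the counting asymptotics over these (\<open>radial_gaussian_asymptotics\<close>) yields the claim
  for it. The product of two Gaussians is a Gaussian, so that their linear combinations form an
  algebra, and even functions are functions of \<open>w = v\<^sup>2\<close>, whose values are separated by three
  suitable Gaussians. By the Weierstrass approximation theorem, \<open>\<psi> exp (|v|\<^sup>2)\<close> is
  therefore a uniform limit on the whole plane of polynomials in these three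
  (\<open>continuous_even_through_gaussian_coords\<close>). Hence \<open>\<psi>\<close> itself is approximated by linear
  combinations of Gaussians with an error at most \<open>\<epsilon> exp (- |v|\<^sup>2)\<close>, which remains small
  after summation over \<open>\<Pi>(q)/R\<close> (\<open>equidistributes_closed\<close>).
  
  The identity \<open>\<Pi>(q(g)) = g \<Pi>(q)\<close> rests on a description of the natural parameters of
  \<open>e\<^sup>-\<^sup>2\<^sup>i\<^sup>\<theta> q(g)\<close> as the functions \<open>e\<^sup>-\<^sup>i\<^sup>\<theta> (g \<circ> u)\<close> with \<open>u\<close> a natural parameter of \<open>q\<close>
  (\<open>natural_parameters_rotate_act\<close>): all horizontal trajectories that occur are lines in some
  direction in the natural parameters of the one differential \<open>q\<close>.
\<close>

section \<open>Charts that are locally affine functions of each other\<close>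

lemma is_chartD:
  assumes "is_chart T (U, u)"
  shows is_chart_openin: "openin T U"
    and is_chart_inj_on: "inj_on u U"
    and is_chart_open_image: "\<And>N. openin T N \<Longrightarrow> N \<subseteq> U \<Longrightarrow> open (u ` N)"
    and is_chart_open_vimage: "\<And>B. open B \<Longrightarrow> openin T {x \<in> U. u x \<in> B}"
proof -
  from assms have U: "openin T U" and o: "open (u ` U)"
    and h: "homeomorphic_map (subtopology T U) (top_of_set (u ` U)) u"
    by (auto simp: is_chart_def)
  have top: "topspace (subtopology T U) = U"
    using openin_subset[OF U] by auto
  show "openin T U" by (fact U)
  show "inj_on u U"
    using homeomorphic_imp_injective_map[OF h] unfolding top .
  show "open (u ` N)" if "openin T N" "N \<subseteq> U" for N
  proof -
    have "openin (subtopology T U) N"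
      using that U by (simp add: openin_open_subtopology)
    then have "openin (top_of_set (u ` U)) (u ` N)"
      using homeomorphic_imp_open_map[OF h] by (simp add: open_map_def)
    then show ?thesis using o openin_open_eq by blast
  qed
  show "openin T {x \<in> U. u x \<in> B}" if "open B" for B
  proof -
    have "openin (top_of_set (u ` U)) (u ` U \<inter> B)"
      using that by (simp add: openin_open_Int)
    then have "openin (subtopology T U) {x \<in> topspace (subtopology T U). u x \<in> u ` U \<inter> B}"
      using homeomorphic_imp_continuous_map[OF h] openin_continuous_map_preimage by blast
    moreover have "{x \<in> topspace (subtopology T U). u x \<in> u ` U \<inter> B} = {x \<in> U. u x \<in> B}"
      unfolding top by blast
    ultimately have "openin (subtopology T U) {x \<in> U. u x \<in> B}" by metis
    then show ?thesis using U openin_open_subtopology by blast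
  qed
qed

lemma is_chart_compose:
  assumes "is_chart T (U, u)" and c: "continuous_on UNIV h" "continuous_on UNIV h'"
    and inv: "\<And>z. h' (h z) = z" "\<And>z. h (h' z) = z"
  shows "is_chart T (U, h \<circ> u)"
proof -
  have h: "homeomorphism UNIV UNIV h h'"
    using c surjI[of h, OF inv(2)] surjI[of h', OF inv(1)] inv by (auto simp: homeomorphism_def)
  have U: "openin T U" and o: "open (u ` U)"
    and hu: "homeomorphic_map (subtopology T U) (top_of_set (u ` U)) u"
    using assms(1) by (auto simp: is_chart_def)
  have im: "(h \<circ> u) ` U = h ` u ` U" by (rule image_comp[symmetric])
  have "open (h ` u ` U)"
    using homeomorphism_imp_open_map[OF h, of "u ` U"] o by simp
  moreover have "homeomorphism (u ` U) (h ` u ` U) h h'"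
    using homeomorphism_of_subsets[OF h] by (metis subset_UNIV)
  then have "homeomorphic_map (top_of_set (u ` U)) (top_of_set (h ` u ` U)) h"
    unfolding homeomorphic_map_maps homeomorphic_maps_def homeomorphism_def
    by (intro exI[of _ h']) (auto simp: continuous_map_in_subtopology)
  then have "homeomorphic_map (subtopology T U) (top_of_set (h ` u ` U)) (h \<circ> u)"
    using hu homeomorphic_map_compose by blast
  ultimately show ?thesis using U unfolding is_chart_def prod.case im by blast
qed

lemma compatible_refl: "is_chart T c \<Longrightarrow> compatible c c"
proof (cases c)
  case (Pair U u)
  assume "is_chart T c"
  then have "inj_on u U" using Pair is_chart_inj_on by blast
  then have "transition (U, u) (U, u) z = z" if "z \<in> u ` U" for z
    using that by (auto simp: transition_def)
  then have "transition (U, u) (U, u) holomorphic_on u ` U"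
    by (intro holomorphic_transform[OF holomorphic_on_ident[of "u ` U"]]) simp
  then show ?thesis by (simp add: Pair compatible_def)
qed

lemma field_differentiable_transform_open:
  assumes "f field_differentiable at z" "open A" "z \<in> A" "\<And>w. w \<in> A \<Longrightarrow> f w = g w"
  shows "g field_differentiable at z"
  using assms has_field_derivative_transform_within_open unfolding field_differentiable_def by metis

text \<open>
  Holomorphy of a transition function is a local property, so a chart inherits compatibility from any
  charts of which it is locally a complex affine function. Every membership in an atlas below is
  proved in this way.
\<close>

lemma compatible_if_locally_affine:
  assumes u: "is_chart T (U, u)" and v: "is_chart T (V, v)"
    and loc: "\<And>p. p \<in> U \<Longrightarrow> p \<in> V \<Longrightarrow> \<exists>N W w e k. openin T N \<and> p \<in> N \<and> N \<subseteq> U \<inter> W \<and> e \<noteq> 0 \<and>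
      (\<forall>x\<in>N. u x = e * w x + k) \<and> is_chart T (W, w) \<and> compatible (W, w) (V, v)"
  shows "compatible (U, u) (V, v)"
proof -
  have "transition (U, u) (V, v) field_differentiable at (u p) \<and>
        transition (V, v) (U, u) field_differentiable at (v p)" if p: "p \<in> U" "p \<in> V" for p
  proof -
    obtain N0 W w e k where N0: "openin T N0" "p \<in> N0" "N0 \<subseteq> U \<inter> W" and e: "e \<noteq> 0"
      and eq: "\<forall>x\<in>N0. u x = e * w x + k" and w: "is_chart T (W, w)" and c: "compatible (W, w) (V, v)"
      using loc[OF p] by blast
    define N where "N = N0 \<inter> V"
    have N: "openin T N" "p \<in> N" "N \<subseteq> U" "N \<subseteq> V" "N \<subseteq> W" "openin T (W \<inter> V)"
      using N0 p is_chart_openin[OF v] is_chart_openin[OF w] unfolding N_def by auto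
    have eqN: "u x = e * w x + k" if "x \<in> N" for x using eq that by (auto simp: N_def)
    note inj = is_chart_inj_on[OF u] is_chart_inj_on[OF v] is_chart_inj_on[OF w]
    have oW: "open (w ` (W \<inter> V))" "open (v ` (W \<inter> V))"
      using is_chart_open_image[OF w] is_chart_open_image[OF v] N by auto
    have h: "(v \<circ> inv_into W w) holomorphic_on w ` (W \<inter> V)" "(w \<circ> inv_into V v) holomorphic_on v ` (W \<inter> V)"
      using c by (auto simp: compatible_def transition_def Int_commute)
    have "((v \<circ> inv_into W w) \<circ> (\<lambda>z. (z - k) / e)) field_differentiable at (u p)"
    proof (rule field_differentiable_compose)
      show "(\<lambda>z. (z - k) / e) field_differentiable at (u p)"
        using e by (auto intro!: derivative_intros)
      have "(u p - k) / e = w p" using eqN[of p] N e by simp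
      then show "(v \<circ> inv_into W w) field_differentiable at ((u p - k) / e)"
        using h(1) oW(1) N by (metis IntI holomorphic_on_imp_differentiable_at imageI in_mono)
    qed
    then have 1: "(v \<circ> inv_into U u) field_differentiable at (u p)"
    proof (rule field_differentiable_transform_open)
      show "open (u ` N)" "u p \<in> u ` N" using is_chart_open_image[OF u] N by auto
      fix z assume "z \<in> u ` N"
      then obtain x where x: "x \<in> N" "z = u x" by auto
      have "(z - k) / e = w x" using x eqN e by simp
      moreover have "inv_into U u (u x) = x" "inv_into W w (w x) = x"
        using x N inj by (auto intro!: inv_into_f_f)
      ultimately show "((v \<circ> inv_into W w) \<circ> (\<lambda>z. (z - k) / e)) z = (v \<circ> inv_into U u) z"
        using x by simp
    qed
    have "(\<lambda>z. e * (w \<circ> inv_into V v) z + k) field_differentiable at (v p)"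
      using h(2) oW(2) N by (intro derivative_intros) (metis IntI holomorphic_on_imp_differentiable_at imageI in_mono)
    then have 2: "(u \<circ> inv_into V v) field_differentiable at (v p)"
    proof (rule field_differentiable_transform_open)
      show "open (v ` N)" "v p \<in> v ` N" using is_chart_open_image[OF v] N by auto
      fix z assume "z \<in> v ` N"
      then obtain x where x: "x \<in> N" "z = v x" by auto
      moreover have "inv_into V v (v x) = x"
        using x N inj by (auto intro!: inv_into_f_f)
      ultimately show "e * (w \<circ> inv_into V v) z + k = (u \<circ> inv_into V v) z"
        using eqN by simp
    qed
    show ?thesis using 1 2 by (simp add: transition_def)
  qed
  then show ?thesis
    by (auto simp: compatible_def holomorphic_on_def field_differentiable_at_within)
qed

lemma transition_derivative_affine:
  assumes u: "is_chart T (U, u)" and N: "openin T N" "p \<in> N" "N \<subseteq> U"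
    and eq: "\<And>x. x \<in> N \<Longrightarrow> v x = e * u x + k"
  shows "(transition (U, u) (V, v) has_field_derivative e) (at (u p))"
proof -
  have "((\<lambda>z. e * z + k) has_field_derivative e) (at (u p))"
    by (auto intro!: derivative_eq_intros)
  then show ?thesis
  proof (rule has_field_derivative_transform_within_open)
    show "open (u ` N)" "u p \<in> u ` N" using is_chart_open_image[OF u] N by auto
    fix z assume "z \<in> u ` N"
    then obtain x where x: "x \<in> N" "z = u x" by blast
    then have "inv_into U u (u x) = x" using N is_chart_inj_on[OF u] by (intro inv_into_f_f) auto
    then show "e * z + k = transition (U, u) (V, v) z"
      using eq[OF x(1)] x by (simp add: transition_def)
  qed
qed

text \<open>
  The derivative is continuous with only two possible values, hence constant on the connected ball.
\<close>

lemma affine_if_derivative_square_const: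
  fixes f :: "complex \<Rightarrow> complex"
  assumes f: "f holomorphic_on ball z r" and r: "r > 0"
    and sq: "\<And>w. w \<in> ball z r \<Longrightarrow> (deriv f w)\<^sup>2 = a\<^sup>2"
  shows "\<exists>e\<in>{a, -a}. \<exists>k. \<forall>w\<in>ball z r. f w = e * w + k"
proof -
  have "continuous_on (ball z r) (deriv f)"
    by (intro holomorphic_on_imp_continuous_on holomorphic_deriv f) auto
  moreover have "deriv f w \<in> {a, -a}" if "w \<in> ball z r" for w
    using sq[OF that] by (simp add: power2_eq_iff)
  then have "deriv f ` ball z r \<subseteq> {a, -a}" by blast
  then have "finite (deriv f ` ball z r)" by (rule finite_subset) simp
  ultimately have "deriv f constant_on ball z r"
    by (intro continuous_finite_range_constant) auto
  then obtain e where e: "\<And>w. w \<in> ball z r \<Longrightarrow> deriv f w = e"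
    by (auto simp: constant_on_def)
  have "e \<in> {a, -a}" using sq[of z] e[of z] r by (simp add: power2_eq_iff)
  moreover have "\<exists>k. \<forall>w\<in>ball z r. f w - e * w = k"
  proof (rule has_field_derivative_zero_constant)
    fix w assume w: "w \<in> ball z r"
    have "(f has_field_derivative deriv f w) (at w)"
      using f w by (intro holomorphic_derivI[of _ "ball z r"]) auto
    then have "((\<lambda>w. f w - e * w) has_field_derivative 0) (at w)"
      by (auto intro!: derivative_eq_intros simp: e[OF w])
    then show "((\<lambda>w. f w - e * w) has_field_derivative 0) (at w within ball z r)"
      by (rule has_field_derivative_at_within)
  qed simp
  then obtain k where "\<forall>w\<in>ball z r. f w - e * w = k" by blast
  then have "\<forall>w\<in>ball z r. f w = e * w + k" by (auto simp: algebra_simps)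
  ultimately show ?thesis by blast
qed

text \<open>
  Two charts in which a quadratic differential has constant coefficients satisfy the hypothesis, by the
  transformation rule. Thus natural parameters are unique up to sign and translation.
\<close>

lemma locally_affine_if_derivative:
  assumes u: "is_chart T (U, u)" and v: "is_chart T (V, v)" and c: "compatible (U, u) (V, v)"
    and p: "p \<in> U" "p \<in> V"
    and sq: "\<And>x. x \<in> U \<Longrightarrow> x \<in> V \<Longrightarrow> (deriv (transition (U, u) (V, v)) (u x))\<^sup>2 = a\<^sup>2"
  shows "\<exists>N e k. openin T N \<and> p \<in> N \<and> N \<subseteq> U \<inter> V \<and> e \<in> {a, -a} \<and> (\<forall>x\<in>N. v x = e * u x + k)"
proof -
  have UV: "openin T (U \<inter> V)" using is_chart_openin[OF u] is_chart_openin[OF v] by auto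
  then have "open (u ` (U \<inter> V))" using is_chart_open_image[OF u] by auto
  then obtain r where r: "r > 0" "ball (u p) r \<subseteq> u ` (U \<inter> V)"
    using p open_contains_ball by (metis IntI imageI)
  let ?f = "transition (U, u) (V, v)"
  have "?f holomorphic_on ball (u p) r"
    using c r by (auto simp: compatible_def intro: holomorphic_on_subset)
  moreover have "(deriv ?f w)\<^sup>2 = a\<^sup>2" if "w \<in> ball (u p) r" for w
    using that r(2) sq by auto
  ultimately obtain e k where e: "e \<in> {a, -a}" and k: "\<And>w. w \<in> ball (u p) r \<Longrightarrow> ?f w = e * w + k"
    using affine_if_derivative_square_const[of ?f "u p" r a] r(1) by blast
  define N where "N = {x \<in> U. u x \<in> ball (u p) r} \<inter> V"
  have "openin T N" unfolding N_def
    by (intro openin_Int is_chart_open_vimage[OF u] is_chart_openin[OF v]) auto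
  moreover have "p \<in> N" "N \<subseteq> U \<inter> V" using p r by (auto simp: N_def)
  moreover have "v x = e * u x + k" if "x \<in> N" for x
    using k[of "u x"] that is_chart_inj_on[OF u] by (auto simp: N_def transition_def)
  ultimately show ?thesis using e by blast
qed

section \<open>Natural parameters of rotated and deformed differentials\<close>

context
  fixes S :: "'a quad_surface"
  assumes S: "closed_quad_surface S"
begin

lemma atlas_charts: "c \<in> qatlas S \<Longrightarrow> is_chart (qtop S) c"
  and atlas_compatible: "c \<in> qatlas S \<Longrightarrow> d \<in> qatlas S \<Longrightarrow> compatible c d"
  and atlas_maximal: "is_chart (qtop S) c \<Longrightarrow> (\<And>d. d \<in> qatlas S \<Longrightarrow> compatible c d) \<Longrightarrow> c \<in> qatlas S"
proof -
  have "complex_structure (qtop S) (qatlas S)"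
    using S by (simp add: closed_quad_surface_def closed_riemann_surface_def)
  then show "c \<in> qatlas S \<Longrightarrow> is_chart (qtop S) c"
    and "c \<in> qatlas S \<Longrightarrow> d \<in> qatlas S \<Longrightarrow> compatible c d"
    and "is_chart (qtop S) c \<Longrightarrow> (\<And>d. d \<in> qatlas S \<Longrightarrow> compatible c d) \<Longrightarrow> c \<in> qatlas S"
    unfolding complex_structure_def by blast+
qed

lemma qcoeff_transform:
  assumes "(U, u) \<in> qatlas S" "(V, v) \<in> qatlas S" "p \<in> U" "p \<in> V"
  shows "qcoeff S (U, u) p = qcoeff S (V, v) p * (deriv (transition (U, u) (V, v)) (u p))\<^sup>2"
  using S assms unfolding closed_quad_surface_def by fastforce

lemma natural_chart: "(U, u) \<in> natural_parameters S \<Longrightarrow> is_chart (qtop S) (U, u)"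
  using atlas_charts by (auto simp: natural_parameters_def)

lemma natural_parameters_overlap:
  assumes u: "(U, u) \<in> natural_parameters S" and v: "(V, v) \<in> natural_parameters S" and p: "p \<in> U" "p \<in> V"
  shows "\<exists>N e k. openin (qtop S) N \<and> p \<in> N \<and> N \<subseteq> U \<inter> V \<and> e \<in> {1, -1} \<and> (\<forall>x\<in>N. v x = e * u x + k)"
proof -
  have uv: "(U, u) \<in> qatlas S" "(V, v) \<in> qatlas S" "\<And>x. x \<in> U \<Longrightarrow> qcoeff S (U, u) x = 1"
     "\<And>x. x \<in> V \<Longrightarrow> qcoeff S (V, v) x = 1"
    using u v by (auto simp: natural_parameters_def)
  show ?thesis
    using qcoeff_transform[OF uv(1,2)] uv p
    by (intro locally_affine_if_derivative atlas_charts atlas_compatible) auto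
qed

lemma atlas_scale:
  assumes u: "(U, u) \<in> qatlas S" and a: "a \<noteq> 0"
  shows "(U, \<lambda>x. a * u x) \<in> qatlas S"
    and "p \<in> U \<Longrightarrow> qcoeff S (U, u) p = qcoeff S (U, \<lambda>x. a * u x) p * a\<^sup>2"
proof -
  have "is_chart (qtop S) (U, (\<lambda>z. a * z) \<circ> u)"
    using a by (intro is_chart_compose[OF atlas_charts[OF u], where h' = "\<lambda>z. z / a"] continuous_intros) auto
  then have c: "is_chart (qtop S) (U, \<lambda>x. a * u x)" by (simp add: o_def)
  show m: "(U, \<lambda>x. a * u x) \<in> qatlas S"
  proof (rule atlas_maximal[OF c])
    fix d assume d: "d \<in> qatlas S"
    obtain V v where [simp]: "d = (V, v)" by (cases d)
    show "compatible (U, \<lambda>x. a * u x) d" unfolding \<open>d = (V, v)\<close>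
    proof (rule compatible_if_locally_affine[OF c])
      show "is_chart (qtop S) (V, v)" using atlas_charts d by auto
      fix p assume "p \<in> U" "p \<in> V"
      then show "\<exists>N W w e k. openin (qtop S) N \<and> p \<in> N \<and> N \<subseteq> U \<inter> W \<and> e \<noteq> 0 \<and>
         (\<forall>x\<in>N. a * u x = e * w x + k) \<and> is_chart (qtop S) (W, w) \<and> compatible (W, w) (V, v)"
        using a atlas_charts[OF u] atlas_compatible[OF u d] is_chart_openin[OF atlas_charts[OF u]]
        by (intro exI[of _ U] exI[of _ u] exI[of _ a] exI[of _ 0]) auto
    qed
  qed
  assume p: "p \<in> U"
  have "deriv (transition (U, u) (U, \<lambda>x. a * u x)) (u p) = a"
    by (intro DERIV_imp_deriv transition_derivative_affine[of "qtop S", where N = U and k = 0]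
        atlas_charts u is_chart_openin[OF atlas_charts[OF u]] p) auto
  then show "qcoeff S (U, u) p = qcoeff S (U, \<lambda>x. a * u x) p * a\<^sup>2"
    using qcoeff_transform[OF u m p p] by simp
qed

lemma natural_parameters_rotate:
  "natural_parameters (rotate_quad \<theta> S) = (\<lambda>(U, u). (U, \<lambda>x. cis (-\<theta>) * u x)) ` natural_parameters S"
proof (intro equalityI subsetI)
  fix d assume d: "d \<in> natural_parameters (rotate_quad \<theta> S)"
  obtain U v where [simp]: "d = (U, v)" by (cases d)
  have v: "(U, v) \<in> qatlas S" and co: "\<And>p. p \<in> U \<Longrightarrow> cis (- 2 * \<theta>) * qcoeff S (U, v) p = 1"
    using d by (auto simp: natural_parameters_def rotate_quad_def)
  have "qcoeff S (U, \<lambda>x. cis \<theta> * v x) p = 1" if "p \<in> U" for p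
  proof -
    have "1 = cis (- 2 * \<theta>) * (qcoeff S (U, \<lambda>x. cis \<theta> * v x) p * (cis \<theta>)\<^sup>2)"
      using atlas_scale(2)[OF v, of "cis \<theta>" p] co[OF that] that by simp
    also have "\<dots> = qcoeff S (U, \<lambda>x. cis \<theta> * v x) p * (cis (- 2 * \<theta>) * (cis \<theta>)\<^sup>2)" by simp
    also have "cis (- 2 * \<theta>) * (cis \<theta>)\<^sup>2 = 1" by (simp add: power2_eq_square cis_mult)
    finally show ?thesis by simp
  qed
  then have "(U, \<lambda>x. cis \<theta> * v x) \<in> natural_parameters S"
    using atlas_scale(1)[OF v, of "cis \<theta>"] by (auto simp: natural_parameters_def)
  moreover have "d = (\<lambda>(U, u). (U, \<lambda>x. cis (-\<theta>) * u x)) (U, \<lambda>x. cis \<theta> * v x)"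
    by (simp add: mult.assoc[symmetric] cis_mult)
  ultimately show "d \<in> (\<lambda>(U, u). (U, \<lambda>x. cis (-\<theta>) * u x)) ` natural_parameters S" by (rule rev_image_eqI)
next
  fix d assume "d \<in> (\<lambda>(U, u). (U, \<lambda>x. cis (-\<theta>) * u x)) ` natural_parameters S"
  then obtain U u where u: "(U, u) \<in> natural_parameters S" and d: "d = (U, \<lambda>x. cis (-\<theta>) * u x)" by auto
  have u': "(U, u) \<in> qatlas S" "\<And>p. p \<in> U \<Longrightarrow> qcoeff S (U, u) p = 1"
    using u by (auto simp: natural_parameters_def)
  have "cis (-2 * \<theta>) * qcoeff S d p = 1" if "p \<in> U" for p
    using atlas_scale(2)[OF u'(1), of "cis (-\<theta>)" p] u'(2)[OF that] that 
    by (simp add: d power2_eq_square cis_mult mult.commute)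
  moreover have "d \<in> qatlas S" using atlas_scale(1)[OF u'(1), of "cis (-\<theta>)"] by (simp add: d)
  ultimately show "d \<in> natural_parameters (rotate_quad \<theta> S)"
    by (auto simp: natural_parameters_def rotate_quad_def d)
qed

text \<open>
  A converse to the uniqueness of natural parameters, which turns local information at every point of a
  chart into membership in the maximal atlas.
\<close>

lemma natural_parameter_if_locally_affine:
  assumes u: "is_chart (qtop S) (U, u)"
    and loc: "\<And>p. p \<in> U \<Longrightarrow> \<exists>N W w e k. (W, w) \<in> natural_parameters S \<and> openin (qtop S) N \<and>
      p \<in> N \<and> N \<subseteq> U \<inter> W \<and> e \<in> {1, -1} \<and> (\<forall>x\<in>N. u x = e * w x + k)"
  shows "(U, u) \<in> natural_parameters S"
proof -
  have m: "(U, u) \<in> qatlas S"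
  proof (rule atlas_maximal[OF u])
    fix d assume d: "d \<in> qatlas S"
    obtain V v where dd: "d = (V, v)" by (cases d)
    show "compatible (U, u) d" unfolding dd
    proof (rule compatible_if_locally_affine[OF u])
      show "is_chart (qtop S) (V, v)" using atlas_charts d dd by auto
      fix p assume "p \<in> U"
      then obtain N W w e k where *: "(W, w) \<in> natural_parameters S" "openin (qtop S) N"
        "p \<in> N" "N \<subseteq> U \<inter> W" "e \<in> {1, -1}" "\<forall>x\<in>N. u x = e * w x + k"
        using loc by blast
      then have "(W, w) \<in> qatlas S" by (simp add: natural_parameters_def)
      then have "is_chart (qtop S) (W, w)" "compatible (W, w) (V, v)"
        using atlas_charts atlas_compatible d dd by blast+
      moreover have "e \<noteq> 0" using * by auto
      ultimately show "\<exists>N W w e k. openin (qtop S) N \<and> p \<in> N \<and> N \<subseteq> U \<inter> W \<and> e \<noteq> 0 \<and>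
         (\<forall>x\<in>N. u x = e * w x + k) \<and> is_chart (qtop S) (W, w) \<and> compatible (W, w) (V, v)"
        using * by blast
    qed
  qed
  moreover have "qcoeff S (U, u) p = 1" if p: "p \<in> U" for p
  proof -
    obtain N W w e k where *: "(W, w) \<in> natural_parameters S" "openin (qtop S) N"
        "p \<in> N" "N \<subseteq> U \<inter> W" "e \<in> {1, -1}" "\<forall>x\<in>N. u x = e * w x + k"
      using loc[OF p] by blast
    then have w: "(W, w) \<in> qatlas S" "p \<in> W" "qcoeff S (W, w) p = 1"
      by (auto simp: natural_parameters_def)
    have "(transition (W, w) (U, u) has_field_derivative e) (at (w p))"
      using * by (intro transition_derivative_affine[OF atlas_charts[OF w(1)], of N]) auto
    then have "deriv (transition (W, w) (U, u)) (w p) = e" by (rule DERIV_imp_deriv)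
    then show ?thesis using qcoeff_transform[OF w(1) m w(2) p] w(3) *(5) by auto
  qed
  ultimately show ?thesis by (simp add: natural_parameters_def)
qed

end

text \<open>
  The action of the adjugate matrix, hence of the inverse for determinant 1.
\<close>

definition mat_act_inv :: "real^2^2 \<Rightarrow> complex \<Rightarrow> complex" where
  "mat_act_inv g z = Complex (vec_nth (vec_nth g 2) 2 * Re z - vec_nth (vec_nth g 1) 2 * Im z)
     (vec_nth (vec_nth g 1) 1 * Im z - vec_nth (vec_nth g 2) 1 * Re z)"

lemma linear_mat_act: "linear (mat_act g)"
  and linear_mat_act_inv: "linear (mat_act_inv g)"
  by (auto simp: linear_iff mat_act_def mat_act_inv_def complex_eq_iff algebra_simps)

lemma mat_act_inverse:
  assumes "det g = 1"
  shows "mat_act_inv g (mat_act g z) = z" "mat_act g (mat_act_inv g z) = z"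
proof -
  define a b c d where "a = vec_nth (vec_nth g 1) 1" "b = vec_nth (vec_nth g 1) 2"
    "c = vec_nth (vec_nth g 2) 1" "d = vec_nth (vec_nth g 2) 2"
  have *: "a * d = 1 + b * c" using assms by (simp add: det_2 a_b_c_d_def)
  have "d * (a * x + b * y) - b * (c * x + d * y) = (a * d) * x - b * c * x"
       "a * (c * x + d * y) - c * (a * x + b * y) = (a * d) * y - b * c * y"
       "a * (d * x - b * y) + b * (a * y - c * x) = (a * d) * x - b * c * x"
       "c * (d * x - b * y) + d * (a * y - c * x) = (a * d) * y - b * c * y" for x y
    by algebra+
  then show "mat_act_inv g (mat_act g z) = z" "mat_act g (mat_act_inv g z) = z"
    unfolding * by (auto simp: mat_act_def mat_act_inv_def complex_eq_iff simp flip: a_b_c_d_def)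
       (auto simp: algebra_simps)
qed

lemma continuous_on_mat_act: "continuous_on A (mat_act g)" "continuous_on A (mat_act_inv g)"
  using linear_continuous_on linear_conv_bounded_linear linear_mat_act linear_mat_act_inv by blast+

text \<open>
  Of the complex scalars, only the real ones commute with every real linear map. The transition
  functions between natural parameters involve no others.
\<close>

lemma mat_act_affine:
  assumes "e \<in> {1, -1}"
  shows "mat_act g (e * z + k) = e * mat_act g z + mat_act g k"
        "mat_act_inv g (e * z + k) = e * mat_act_inv g z + mat_act_inv g k"
  using assms by (auto simp: linear_add[OF linear_mat_act] linear_add[OF linear_mat_act_inv]
      linear_neg[OF linear_mat_act] linear_neg[OF linear_mat_act_inv])

context
  fixes S :: "'a quad_surface" and g :: "real^2^2"
  assumes S: "closed_quad_surface S" and g: "det g = 1"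
begin

lemma natural_chart_act:
  "(U, u) \<in> natural_parameters S \<Longrightarrow> is_chart (qtop S) (U, mat_act g \<circ> u)"
  by (rule is_chart_compose[OF natural_chart[OF S], where h' = "mat_act_inv g"])
     (auto simp: continuous_on_mat_act mat_act_inverse[OF g])

text \<open>
  Transition functions \<open>\<plusminus>z + k\<close> keep this form under conjugation by \<open>g\<close>, so the deformed
  charts are again compatible with each other.
\<close>

lemma natural_overlap_act:
  assumes u: "(U, u) \<in> natural_parameters S" and v: "(V, v) \<in> natural_parameters S" and p: "p \<in> U" "p \<in> V"
  shows "\<exists>N e k. openin (qtop S) N \<and> p \<in> N \<and> N \<subseteq> U \<inter> V \<and> e \<in> {1, -1} \<and>
    (\<forall>x\<in>N. mat_act g (v x) = e * mat_act g (u x) + k)"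
proof -
  obtain N e k where N: "openin (qtop S) N" "p \<in> N" "N \<subseteq> U \<inter> V" and e: "e \<in> {1, -1}"
    and eq: "\<forall>x\<in>N. v x = e * u x + k"
    using natural_parameters_overlap[OF S u v p] by blast
  have "\<forall>x\<in>N. mat_act g (v x) = e * mat_act g (u x) + mat_act g k"
    using eq mat_act_affine(1)[OF e] by simp
  then show ?thesis using N e by blast
qed

text \<open>
  The coefficient of \<open>q(g)\<close> is defined by an arbitrary choice among the deformed natural
  parameters at each point. The choice does not matter, since they differ by sign and translation; and
  only then can the coefficient be computed with one fixed parameter in a neighbourhood.
\<close>

lemma deriv_transition_act:
  assumes \<phi>: "is_chart (qtop S) (U, \<phi>)" and c: "\<And>d. d \<in> act_natural g S \<Longrightarrow> compatible (U, \<phi>) d"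
    and v: "(V, v) \<in> natural_parameters S" and w: "(W, w) \<in> natural_parameters S"
    and p: "p \<in> U" "p \<in> V" "p \<in> W"
  shows "(deriv (transition (U, \<phi>) (V, mat_act g \<circ> v)) (\<phi> p))\<^sup>2 =
    (deriv (transition (U, \<phi>) (W, mat_act g \<circ> w)) (\<phi> p))\<^sup>2"
proof -
  obtain N e k where N: "openin (qtop S) N" "p \<in> N" "N \<subseteq> V \<inter> W" and e: "e \<in> {1, -1}"
    and eq: "\<forall>x\<in>N. mat_act g (w x) = e * mat_act g (v x) + k"
    using natural_overlap_act[OF v w p(2,3)] by blast
  have NU: "openin (qtop S) (N \<inter> U)" using N is_chart_openin[OF \<phi>] by auto
  have "(V, mat_act g \<circ> v) \<in> act_natural g S" using v by (auto simp: act_natural_def)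
  then have "transition (U, \<phi>) (V, mat_act g \<circ> v) holomorphic_on \<phi> ` (U \<inter> V)"
    using c by (auto simp: compatible_def)
  moreover have "\<phi> p \<in> \<phi> ` (N \<inter> U)" "open (\<phi> ` (N \<inter> U))" "\<phi> ` (N \<inter> U) \<subseteq> \<phi> ` (U \<inter> V)"
    using p N is_chart_open_image[OF \<phi> NU] by auto
  ultimately have "(transition (U, \<phi>) (V, mat_act g \<circ> v) has_field_derivative
      deriv (transition (U, \<phi>) (V, mat_act g \<circ> v)) (\<phi> p)) (at (\<phi> p))"
    by (meson holomorphic_derivI holomorphic_on_subset)
  then have "((\<lambda>z. e * transition (U, \<phi>) (V, mat_act g \<circ> v) z + k) has_field_derivative
      e * deriv (transition (U, \<phi>) (V, mat_act g \<circ> v)) (\<phi> p)) (at (\<phi> p))"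
    by (auto intro!: derivative_eq_intros)
  then have "(transition (U, \<phi>) (W, mat_act g \<circ> w) has_field_derivative
      e * deriv (transition (U, \<phi>) (V, mat_act g \<circ> v)) (\<phi> p)) (at (\<phi> p))"
  proof (rule has_field_derivative_transform_within_open)
    show "open (\<phi> ` (N \<inter> U))" "\<phi> p \<in> \<phi> ` (N \<inter> U)" by fact+
    fix z assume "z \<in> \<phi> ` (N \<inter> U)"
    then obtain x where x: "x \<in> N" "x \<in> U" "z = \<phi> x" by auto
    then have "inv_into U \<phi> (\<phi> x) = x" using is_chart_inj_on[OF \<phi>] by (intro inv_into_f_f)
    then show "e * transition (U, \<phi>) (V, mat_act g \<circ> v) z + k = transition (U, \<phi>) (W, mat_act g \<circ> w) z"
      using eq x by (simp add: transition_def)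
  qed
  then show ?thesis using e by (auto dest!: DERIV_imp_deriv)
qed

lemma qcoeff_act:
  assumes \<phi>: "(U, \<phi>) \<in> qatlas (act g S)" and v: "(V, v) \<in> natural_parameters S"
    and p: "p \<in> U" "p \<in> V"
  shows "qcoeff (act g S) (U, \<phi>) p = (deriv (transition (U, \<phi>) (V, mat_act g \<circ> v)) (\<phi> p))\<^sup>2"
proof -
  let ?P = "\<lambda>d. d \<in> act_natural g S \<and> p \<in> fst d"
  have ex: "?P (V, mat_act g \<circ> v)" using v p by (auto simp: act_natural_def)
  then have "?P (SOME d. ?P d)" by (rule someI)
  then obtain W w where w: "(W, w) \<in> natural_parameters S" "p \<in> W" "(SOME d. ?P d) = (W, mat_act g \<circ> w)"
    by (auto simp: act_natural_def)
  have "\<exists>d\<in>act_natural g S. p \<in> fst d" using ex by blast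
  then have "qcoeff (act g S) (U, \<phi>) p = (deriv (transition (U, \<phi>) (W, mat_act g \<circ> w)) (\<phi> p))\<^sup>2"
    by (simp add: act_def w(3))
  also have "\<dots> = (deriv (transition (U, \<phi>) (V, mat_act g \<circ> v)) (\<phi> p))\<^sup>2"
    using \<phi> by (intro deriv_transition_act w v p) (auto simp: act_def)
  finally show ?thesis .
qed

text \<open>
  With respect to a natural parameter \<open>\<phi>\<close> of \<open>e\<^sup>-\<^sup>2\<^sup>i\<^sup>\<theta> q(g)\<close>, the derivative of every
  \<open>g \<circ> w\<close> has square \<open>e\<^sup>2\<^sup>i\<^sup>\<theta>\<close>. So \<open>e\<^sup>i\<^sup>\<theta> \<phi>\<close> is locally \<open>\<plusminus>(g \<circ> w) + k\<close>, and
  undoing \<open>g\<close> gives a chart that is locally \<open>\<plusminus>w + k'\<close>.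
\<close>

lemma natural_parameters_rotate_act:
  "natural_parameters (rotate_quad \<theta> (act g S)) =
    (\<lambda>(U, u). (U, \<lambda>x. cis (-\<theta>) * mat_act g (u x))) ` natural_parameters S"
proof (intro equalityI subsetI)
  fix d assume d: "d \<in> natural_parameters (rotate_quad \<theta> (act g S))"
  obtain U \<phi> where dd: "d = (U, \<phi>)" by (cases d)
  have \<phi>: "(U, \<phi>) \<in> qatlas (act g S)"
    and co: "\<And>p. p \<in> U \<Longrightarrow> cis (- 2 * \<theta>) * qcoeff (act g S) (U, \<phi>) p = 1"
    using d dd by (auto simp: natural_parameters_def rotate_quad_def)
  have co': "qcoeff (act g S) (U, \<phi>) p = (cis \<theta>)\<^sup>2" if "p \<in> U" for p
  proof -
    have "qcoeff (act g S) (U, \<phi>) p = cis (2 * \<theta>) * (cis (- 2 * \<theta>) * qcoeff (act g S) (U, \<phi>) p)"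
      by (simp add: cis_mult flip: mult.assoc)
    also have "\<dots> = (cis \<theta>)\<^sup>2" unfolding co[OF that] by (simp add: power2_eq_square cis_mult)
    finally show ?thesis .
  qed
  have ch: "is_chart (qtop S) (U, \<phi>)" and cmp: "\<And>d. d \<in> act_natural g S \<Longrightarrow> compatible (U, \<phi>) d"
    using \<phi> by (auto simp: act_def)
  define u where "u = (\<lambda>x. mat_act_inv g (cis \<theta> * \<phi> x))"
  have "is_chart (qtop S) (U, (\<lambda>z. mat_act_inv g (cis \<theta> * z)) \<circ> \<phi>)"
    by (rule is_chart_compose[OF ch, where h' = "\<lambda>z. cis (-\<theta>) * mat_act g z"])
      (auto intro!: continuous_intros continuous_on_compose2[OF continuous_on_mat_act(2)[of UNIV g]] continuous_on_mat_act
         simp: mat_act_inverse[OF g] cis_mult simp flip: mult.assoc)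
  then have "is_chart (qtop S) (U, u)" by (simp add: u_def o_def)
  then have "(U, u) \<in> natural_parameters S"
  proof (rule natural_parameter_if_locally_affine[OF S])
    fix p assume p: "p \<in> U"
    \<comment> \<open>A point covered by no deformed natural parameter has coefficient 0 and not \<open>e\<^sup>2\<^sup>i\<^sup>\<theta>\<close>.\<close>
    have "\<exists>d\<in>act_natural g S. p \<in> fst d"
      using co[OF p] by (auto simp: act_def split: if_splits)
    then obtain W w where w: "(W, w) \<in> natural_parameters S" "p \<in> W"
      by (auto simp: act_natural_def)
    have "\<exists>N e k. openin (qtop S) N \<and> p \<in> N \<and> N \<subseteq> U \<inter> W \<and> e \<in> {cis \<theta>, -cis \<theta>} \<and>
        (\<forall>x\<in>N. (mat_act g \<circ> w) x = e * \<phi> x + k)"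
    proof (rule locally_affine_if_derivative[OF ch natural_chart_act[OF w(1)] cmp p w(2)])
      show "(W, mat_act g \<circ> w) \<in> act_natural g S" using w by (auto simp: act_natural_def)
      fix x assume "x \<in> U" "x \<in> W"
      then show "(deriv (transition (U, \<phi>) (W, mat_act g \<circ> w)) (\<phi> x))\<^sup>2 = (cis \<theta>)\<^sup>2"
        using qcoeff_act[OF \<phi> w(1)] co' by simp
    qed
    then obtain N e k where N: "openin (qtop S) N" "p \<in> N" "N \<subseteq> U \<inter> W" and e: "e \<in> {cis \<theta>, -cis \<theta>}"
      and eq: "\<forall>x\<in>N. (mat_act g \<circ> w) x = e * \<phi> x + k" by blast
    obtain s where s: "s \<in> {1, -1}" "s * e = cis \<theta>" using e by force
    have "u x = s * w x + mat_act_inv g (- s * k)" if "x \<in> N" for x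
    proof -
      have "cis \<theta> * \<phi> x = s * mat_act g (w x) + (- s * k)"
        using eq that by (simp add: algebra_simps flip: s(2))
      then have "u x = mat_act_inv g (s * mat_act g (w x) + (- s * k))" by (simp only: u_def)
      then show ?thesis by (simp only: mat_act_affine(2)[OF s(1)] mat_act_inverse[OF g])
    qed
    then show "\<exists>N W w e k. (W, w) \<in> natural_parameters S \<and> openin (qtop S) N \<and>
      p \<in> N \<and> N \<subseteq> U \<inter> W \<and> e \<in> {1, -1} \<and> (\<forall>x\<in>N. u x = e * w x + k)"
      using w N s(1) by blast
  qed
  moreover have "d = (\<lambda>(U, u). (U, \<lambda>x. cis (-\<theta>) * mat_act g (u x))) (U, u)"
    by (simp add: dd u_def mat_act_inverse[OF g] cis_mult flip: mult.assoc)
  ultimately show "d \<in> (\<lambda>(U, u). (U, \<lambda>x. cis (-\<theta>) * mat_act g (u x))) ` natural_parameters S"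
    by (rule rev_image_eqI)
next
  fix d assume "d \<in> (\<lambda>(U, u). (U, \<lambda>x. cis (-\<theta>) * mat_act g (u x))) ` natural_parameters S"
  then obtain U u where u: "(U, u) \<in> natural_parameters S"
    and dd: "d = (U, \<lambda>x. cis (-\<theta>) * mat_act g (u x))" by auto
  define \<phi> where "\<phi> = (\<lambda>x. cis (-\<theta>) * mat_act g (u x))"
  have "is_chart (qtop S) (U, (\<lambda>z. cis (-\<theta>) * mat_act g z) \<circ> u)"
    by (rule is_chart_compose[OF natural_chart[OF S u], where h' = "\<lambda>z. mat_act_inv g (cis \<theta> * z)"])
      (auto intro!: continuous_intros continuous_on_compose2[OF continuous_on_mat_act(2)[of UNIV g]] continuous_on_mat_act
         simp: mat_act_inverse[OF g] cis_mult simp flip: mult.assoc)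
  then have ch: "is_chart (qtop S) (U, \<phi>)" by (simp add: \<phi>_def o_def)
  have "compatible (U, \<phi>) d'" if "d' \<in> act_natural g S" for d'
  proof -
    obtain V v where v: "(V, v) \<in> natural_parameters S" and d': "d' = (V, mat_act g \<circ> v)"
      using \<open>d' \<in> act_natural g S\<close> by (auto simp: act_natural_def)
    show ?thesis unfolding d'
    proof (rule compatible_if_locally_affine[OF ch natural_chart_act[OF v]])
      fix p assume p: "p \<in> U" "p \<in> V"
      obtain N e k where N: "openin (qtop S) N" "p \<in> N" "N \<subseteq> V \<inter> U" and e: "e \<in> {1, -1}"
        and eq: "\<forall>x\<in>N. mat_act g (u x) = e * mat_act g (v x) + k"
        using natural_overlap_act[OF v u p(2,1)] by blast
      have "\<phi> x = (cis (-\<theta>) * e) * (mat_act g \<circ> v) x + cis (-\<theta>) * k" if "x \<in> N" for x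
        using eq that by (simp add: \<phi>_def algebra_simps)
      moreover have "cis (-\<theta>) * e \<noteq> 0" "N \<subseteq> U \<inter> V" using e N by auto
      ultimately show "\<exists>N W w e k. openin (qtop S) N \<and> p \<in> N \<and> N \<subseteq> U \<inter> W \<and> e \<noteq> 0 \<and>
         (\<forall>x\<in>N. \<phi> x = e * w x + k) \<and> is_chart (qtop S) (W, w) \<and> compatible (W, w) (V, mat_act g \<circ> v)"
        using N natural_chart_act[OF v] compatible_refl[OF natural_chart_act[OF v]]
        by (intro exI[of _ N] exI[of _ V] exI[of _ "mat_act g \<circ> v"] exI[of _ "cis (-\<theta>) * e"]
            exI[of _ "cis (-\<theta>) * k"]) simp
    qed
  qed
  then have \<phi>: "(U, \<phi>) \<in> qatlas (act g S)" using ch by (simp add: act_def)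
  have "cis (-2 * \<theta>) * qcoeff (act g S) (U, \<phi>) p = 1" if p: "p \<in> U" for p
  proof -
    have "(transition (U, \<phi>) (U, mat_act g \<circ> u) has_field_derivative cis \<theta>) (at (\<phi> p))"
      by (rule transition_derivative_affine[OF ch is_chart_openin[OF ch] p, where k = 0])
        (auto simp: \<phi>_def cis_mult simp flip: mult.assoc)
    then have "qcoeff (act g S) (U, \<phi>) p = (cis \<theta>)\<^sup>2"
      using qcoeff_act[OF \<phi> u p p] by (simp add: DERIV_imp_deriv)
    then show ?thesis by (simp add: power2_eq_square cis_mult)
  qed
  then show "d \<in> natural_parameters (rotate_quad \<theta> (act g S))"
    using \<phi> by (auto simp: natural_parameters_def rotate_quad_def dd \<phi>_def)
qed

end

section \<open>Vectors of cylinders\<close>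

text \<open>
  The foliations of all \<open>e\<^sup>-\<^sup>2\<^sup>i\<^sup>\<theta> q(g)\<close> are described in the natural parameters of \<open>q\<close>, by lines
  of constant velocity \<open>w\<close>. Velocities of arbitrary modulus are needed because \<open>g\<close> does not
  preserve lengths.
\<close>

definition line_trajectory :: "'a quad_surface \<Rightarrow> complex \<Rightarrow> (real \<Rightarrow> 'a) \<Rightarrow> bool" where
  "line_trajectory S w \<gamma> \<longleftrightarrow>
     (\<forall>t. \<exists>(U, u)\<in>natural_parameters S. \<gamma> t \<in> U \<and>
        (\<forall>\<^sub>F s in nhds t. \<gamma> s \<in> U \<and> u (\<gamma> s) = u (\<gamma> t) + of_real (s - t) * w))"

definition closed_line :: "'a quad_surface \<Rightarrow> complex \<Rightarrow> 'a set \<Rightarrow> real \<Rightarrow> bool" where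
  "closed_line S w L r \<longleftrightarrow> r > 0 \<and>
     (\<exists>\<gamma>. line_trajectory S w \<gamma> \<and> L = range \<gamma> \<and>
        (\<forall>s t. \<gamma> s = \<gamma> t \<longleftrightarrow> (\<exists>k::int. s - t = of_int k * r)))"

definition line_cylinder :: "'a quad_surface \<Rightarrow> complex \<Rightarrow> 'a set \<Rightarrow> real \<Rightarrow> bool" where
  "line_cylinder S w C r \<longleftrightarrow>
     C \<in> connected_components_of (subtopology (qtop S) (\<Union>{L. \<exists>l. closed_line S w L l})) \<and>
     {l. \<exists>L\<subseteq>C. closed_line S w L l} = {r}"

lemma line_trajectory_rescale:
  assumes "line_trajectory S (of_real \<rho> * w) \<gamma>" "\<rho> > 0"
  shows "line_trajectory S w (\<lambda>s. \<gamma> (s / \<rho>))"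
  unfolding line_trajectory_def
proof
  fix t
  obtain U u where u: "(U, u) \<in> natural_parameters S" "\<gamma> (t / \<rho>) \<in> U"
    and ev: "\<forall>\<^sub>F s in nhds (t / \<rho>). \<gamma> s \<in> U \<and>
       u (\<gamma> s) = u (\<gamma> (t / \<rho>)) + of_real (s - t / \<rho>) * (of_real \<rho> * w)"
    using assms(1) unfolding line_trajectory_def by blast
  have "filterlim (\<lambda>s. s / \<rho>) (nhds (t / \<rho>)) (nhds t)"
    using \<open>\<rho> > 0\<close> by (auto intro!: tendsto_intros filterlim_ident)
  from eventually_compose_filterlim[OF ev this]
  have "\<forall>\<^sub>F s in nhds t. \<gamma> (s / \<rho>) \<in> U \<and> u (\<gamma> (s / \<rho>)) = u (\<gamma> (t / \<rho>)) + of_real (s - t) * w"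
  proof eventually_elim
    case (elim s)
    have "of_real (s / \<rho> - t / \<rho>) * (of_real \<rho> * w) = of_real ((s / \<rho> - t / \<rho>) * \<rho>) * w"
      by (simp only: of_real_mult mult.assoc)
    also have "(s / \<rho> - t / \<rho>) * \<rho> = s - t" using \<open>\<rho> > 0\<close> by (simp add: field_simps)
    finally show ?case using elim by simp
  qed
  then show "\<exists>(U, u)\<in>natural_parameters S. \<gamma> (t / \<rho>) \<in> U \<and>
      (\<forall>\<^sub>F s in nhds t. \<gamma> (s / \<rho>) \<in> U \<and> u (\<gamma> (s / \<rho>)) = u (\<gamma> (t / \<rho>)) + of_real (s - t) * w)"
    using u by blast
qed

lemma closed_line_rescale_imp:
  assumes "closed_line S (of_real \<rho> * w) L r" "\<rho> > 0"
  shows "closed_line S w L (\<rho> * r)"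
proof -
  obtain \<gamma> where *: "r > 0" "line_trajectory S (of_real \<rho> * w) \<gamma>" "L = range \<gamma>"
    "\<And>s t. \<gamma> s = \<gamma> t \<longleftrightarrow> (\<exists>k::int. s - t = of_int k * r)"
    using assms(1) unfolding closed_line_def by blast
  have "range \<gamma> \<subseteq> range (\<lambda>s. \<gamma> (s / \<rho>))"
  proof
    fix x assume "x \<in> range \<gamma>"
    then obtain s where "x = \<gamma> s" by blast
    then have "x = (\<lambda>s. \<gamma> (s / \<rho>)) (\<rho> * s)" using \<open>\<rho> > 0\<close> by simp
    then show "x \<in> range (\<lambda>s. \<gamma> (s / \<rho>))" by blast
  qed
  then have "L = range (\<lambda>s. \<gamma> (s / \<rho>))" using *(3) by blast
  moreover have "(s / \<rho> - t / \<rho> = of_int k * r) = (s - t = of_int k * (\<rho> * r))" for s t and k :: int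
    using \<open>\<rho> > 0\<close> by (auto simp: field_simps)
  ultimately show ?thesis
    unfolding closed_line_def using * line_trajectory_rescale[OF *(2) \<open>\<rho> > 0\<close>] \<open>\<rho> > 0\<close>
    by (intro conjI exI[of _ "\<lambda>s. \<gamma> (s / \<rho>)"]) auto
qed

lemma closed_line_rescale:
  assumes "\<rho> > 0"
  shows "closed_line S (of_real \<rho> * w) L r \<longleftrightarrow> closed_line S w L (\<rho> * r)"
proof
  assume "closed_line S w L (\<rho> * r)"
  moreover have "of_real (1 / \<rho>) * (of_real \<rho> * w) = w" using assms by (simp add: field_simps)
  ultimately have "closed_line S (of_real \<rho> * w) L (1 / \<rho> * (\<rho> * r))"
    using assms closed_line_rescale_imp[of S "1 / \<rho>" "of_real \<rho> * w" L "\<rho> * r"] by simp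
  then show "closed_line S (of_real \<rho> * w) L r" using assms by simp
qed (use assms closed_line_rescale_imp in blast)

lemma line_cylinder_rescale:
  assumes "\<rho> > 0"
  shows "line_cylinder S (of_real \<rho> * w) C r \<longleftrightarrow> line_cylinder S w C (\<rho> * r)"
proof -
  have "{L. \<exists>l. closed_line S (of_real \<rho> * w) L l} = {L. \<exists>l. closed_line S w L l}"
  proof -
    have "closed_line S w L (\<rho> * (l / \<rho>)) = closed_line S w L l" for L l using assms by simp
    then show ?thesis unfolding closed_line_rescale[OF assms] by metis
  qed
  moreover have "{l. \<exists>L\<subseteq>C. closed_line S (of_real \<rho> * w) L l} = {r} \<longleftrightarrow> {l. \<exists>L\<subseteq>C. closed_line S w L l} = {\<rho> * r}"
  proof -
    define P where "P l \<longleftrightarrow> (\<exists>L\<subseteq>C. closed_line S w L l)" for l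
    have "(\<forall>l. P (\<rho> * l) \<longleftrightarrow> l = r) \<longleftrightarrow> (\<forall>l. P l \<longleftrightarrow> l = \<rho> * r)"
    proof
      assume *: "\<forall>l. P (\<rho> * l) \<longleftrightarrow> l = r"
      show "\<forall>l. P l \<longleftrightarrow> l = \<rho> * r"
        using *[THEN spec, of "_ / \<rho>"] assms by (auto simp: field_simps)
    qed (use assms in auto)
    then show ?thesis unfolding closed_line_rescale[OF assms] P_def by (auto simp: set_eq_iff)
  qed
  ultimately show ?thesis unfolding line_cylinder_def by simp
qed

lemma line_cylinder_pos: "line_cylinder S w C r \<Longrightarrow> r > 0"
  unfolding line_cylinder_def closed_line_def by (auto simp: set_eq_iff)

text \<open>
  The velocity \<open>w\<close> is the one that the real linear change of charts \<open>h\<close> turns into the horizontal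
  unit vector.
\<close>

lemma maximal_cylinder_eq_line_cylinder:
  assumes NP: "natural_parameters T = (\<lambda>(U, u). (U, \<lambda>x. h (u x))) ` natural_parameters S"
    and h: "linear h" "inj h" "h w = 1" and top: "qtop T = qtop S"
  shows "maximal_cylinder T = line_cylinder S w"
proof -
  have *: "h x = h y + of_real r \<longleftrightarrow> x = y + of_real r * w" for x y r
  proof -
    have "h y + of_real r = h (y + of_real r * w)"
      using linear_scale[OF h(1), of r w] h(3) by (simp add: linear_add[OF h(1)] scaleR_conv_of_real)
    then show ?thesis using h(2) by (simp add: inj_eq)
  qed
  have "horizontal_trajectory T \<gamma> = line_trajectory S w \<gamma>" for \<gamma>
    unfolding horizontal_trajectory_def line_trajectory_def NP by (simp add: * case_prod_beta del: of_real_diff)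
  then have "closed_leaf T = closed_line S w"
    by (intro ext) (simp add: closed_leaf_def closed_line_def)
  then show ?thesis by (intro ext) (simp add: maximal_cylinder_def line_cylinder_def top)
qed

text \<open>
  A vector \<open>v\<close> comes from a cylinder iff lines of velocity \<open>\<plusminus>v\<close> close up after time exactly 1 in
  it: the closing time \<open>r\<close> of unit speed leaves is absorbed into the velocity. This form avoids the
  polar decomposition of \<open>v\<close>, which \<open>h'\<close> does not respect.
\<close>

lemma Pi_vectors_eq_line_cylinders:
  assumes NP: "\<And>\<theta>. natural_parameters (rotate_quad \<theta> T) =
      (\<lambda>(U, u). (U, \<lambda>x. cis (-\<theta>) * h (u x))) ` natural_parameters S"
    and h: "linear h" "linear h'" "\<And>z. h' (h z) = z" "\<And>z. h (h' z) = z" and top: "qtop T = qtop S"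
  shows "(C, v) \<in> Pi_vectors T \<longleftrightarrow>
     v \<noteq> 0 \<and> (line_cylinder S (h' v) C 1 \<or> line_cylinder S (- h' v) C 1)"
proof -
  have mc: "maximal_cylinder (rotate_quad \<theta> T) = line_cylinder S (h' (cis \<theta>))" for \<theta>
  proof (rule maximal_cylinder_eq_line_cylinder[OF NP])
    show "linear (\<lambda>z. cis (-\<theta>) * h z)"
      using h(1) by (auto simp: linear_iff algebra_simps)
    have "inj h" by (metis h(3) injI)
    then show "inj (\<lambda>z. cis (-\<theta>) * h z)" by (auto simp: inj_def)
    show "cis (-\<theta>) * h (h' (cis \<theta>)) = 1" by (simp add: h cis_mult)
    show "qtop (rotate_quad \<theta> T) = qtop S" by (simp add: rotate_quad_def top)
  qed
  have sc: "line_cylinder S (h' (cis \<theta>)) C r \<longleftrightarrow> line_cylinder S (h' (of_real r * cis \<theta>)) C 1"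
    if "r > 0" for r \<theta>
    using line_cylinder_rescale[OF that, of S "h' (cis \<theta>)" C 1] linear_scale[OF h(2), of r "cis \<theta>"]
    by (simp add: scaleR_conv_of_real)
  have neg: "h' (- z) = - h' z" for z by (rule linear_neg[OF h(2)])
  show ?thesis
  proof
    assume "(C, v) \<in> Pi_vectors T"
    then obtain \<theta> r where *: "line_cylinder S (h' (cis \<theta>)) C r"
       "v = of_real r * cis \<theta> \<or> v = - (of_real r * cis \<theta>)"
      unfolding Pi_vectors_def by (auto simp: mc)
    have r: "r > 0" using line_cylinder_pos[OF *(1)] .
    have "line_cylinder S (h' (of_real r * cis \<theta>)) C 1" using *(1) sc[OF r] by simp
    then show "v \<noteq> 0 \<and> (line_cylinder S (h' v) C 1 \<or> line_cylinder S (- h' v) C 1)"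
      using *(2) r by (auto simp: neg)
  next
    assume v: "v \<noteq> 0 \<and> (line_cylinder S (h' v) C 1 \<or> line_cylinder S (- h' v) C 1)"
    have "(C, v) \<in> Pi_vectors T" if z: "line_cylinder S (h' z) C 1" "z \<noteq> 0" "v = z \<or> v = - z" for z
    proof -
      have "z = of_real (cmod z) * cis (Arg z)" by (simp add: rcis_cmod_Arg flip: rcis_def)
      moreover have "cmod z > 0" using z by simp
      ultimately have "line_cylinder S (h' (cis (Arg z))) C (cmod z)" using sc z(1) by metis
      then show ?thesis
        using \<open>z = _\<close> z(3) unfolding Pi_vectors_def by (auto simp: mc) metis
    qed
    from this[of v] this[of "-v"] v show "(C, v) \<in> Pi_vectors T" by (auto simp: neg)
  qed
qed

lemma Pi_vectors_iff:
  assumes "closed_quad_surface S"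
  shows "(C, v) \<in> Pi_vectors S \<longleftrightarrow> v \<noteq> 0 \<and> (line_cylinder S v C 1 \<or> line_cylinder S (- v) C 1)"
  by (rule Pi_vectors_eq_line_cylinders[where h = "\<lambda>z. z"])
    (auto simp: natural_parameters_rotate[OF assms] linear_iff)

text \<open>
  This is \<open>\<Pi>(q(g)) = g \<Pi>(q)\<close>; even the cylinders are the same sets.
\<close>

lemma Pi_vectors_act_iff:
  assumes "closed_quad_surface S" "det g = 1"
  shows "(C, mat_act g v) \<in> Pi_vectors (act g S) \<longleftrightarrow> (C, v) \<in> Pi_vectors S"
proof -
  have "mat_act g v = 0 \<longleftrightarrow> v = 0"
    using mat_act_inverse[OF assms(2)] linear_0[OF linear_mat_act] by metis
  moreover have "qtop (act g S) = qtop S" by (simp add: act_def)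
  ultimately show ?thesis
    unfolding Pi_vectors_eq_line_cylinders[OF natural_parameters_rotate_act[OF assms]
        linear_mat_act linear_mat_act_inv mat_act_inverse[OF assms(2)] \<open>qtop _ = _\<close>] Pi_vectors_iff[OF assms(1)]
    by (simp add: mat_act_inverse[OF assms(2)])
qed

lemma N_count_act:
  assumes "closed_quad_surface S" "det g = 1"
  shows "N_count (act g S) R = ext_card {i \<in> Pi_vectors S. cmod (mat_act g (snd i)) < R}"
proof -
  let ?f = "\<lambda>(C :: 'a set, v). (C, mat_act g v)"
  have "{(C, v) \<in> Pi_vectors (act g S). cmod v < R} = ?f ` {i \<in> Pi_vectors S. cmod (mat_act g (snd i)) < R}"
  proof (intro equalityI subsetI)
    fix i assume i: "i \<in> {(C, v) \<in> Pi_vectors (act g S). cmod v < R}"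
    obtain C v where Cv: "i = (C, v)" by (cases i)
    have "i = ?f (C, mat_act_inv g v)" by (simp add: Cv mat_act_inverse[OF assms(2)])
    moreover have "(C, mat_act_inv g v) \<in> Pi_vectors S"
      using Pi_vectors_act_iff[OF assms, of C "mat_act_inv g v"] i by (simp add: Cv mat_act_inverse[OF assms(2)])
    ultimately show "i \<in> ?f ` {i \<in> Pi_vectors S. cmod (mat_act g (snd i)) < R}"
      using i by (intro image_eqI) (auto simp: Cv mat_act_inverse[OF assms(2)])
  qed (use Pi_vectors_act_iff[OF assms] in auto)
  moreover have "inj_on ?f A" for A
  proof (rule inj_on_inverseI)
    show "(\<lambda>(C, v). (C, mat_act_inv g v)) (?f i) = i" for i :: "'a set \<times> complex"
      by (cases i) (simp add: mat_act_inverse[OF assms(2)])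
  qed
  ultimately show ?thesis
    unfolding N_count_def ext_card_def by (simp add: finite_image_iff card_image)
qed

section \<open>Sums of Gaussians\<close>

lemma exp_eq_nn_integral_tail:
  fixes a :: real
  assumes "a \<ge> 0"
  shows "(\<integral>\<^sup>+s. ennreal (exp (- s)) * indicator {a<..} s \<partial>lborel) = ennreal (exp (- a))"
proof -
  have "(\<integral>\<^sup>+s. ennreal (exp (- s)) * indicator {a<..} s \<partial>lborel) =
        (\<integral>\<^sup>+s. ennreal (exp (- s)) * indicator {a..} s \<partial>lborel)"
    by (intro nn_integral_cong_AE AE_I[where N="{a}"]) (auto split: split_indicator)
  also have "\<dots> = ennreal (0 - (- exp (- a)))"
  proof (rule nn_integral_FTC_atLeast)
    show "((\<lambda>s. - exp (- s)) \<longlongrightarrow> (0::real)) at_top" by real_asymp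
  qed (auto intro!: derivative_eq_intros)
  finally show ?thesis by simp
qed

text \<open>
  Fubini, applied to \<open>exp (- a i) = \<integral> exp (- s) 1\<^bsub>a i < s\<^esub> ds\<close>.
\<close>

lemma layer_cake_exp:
  fixes a :: "'i \<Rightarrow> real"
  assumes a: "\<And>i. i \<in> I \<Longrightarrow> a i \<ge> 0" and fin: "\<And>s. finite {i \<in> I. a i < s}"
    and int: "integrable lborel (\<lambda>s. real (card {i \<in> I. a i < s}) * exp (- s))"
  shows "((\<lambda>i. exp (- a i)) has_sum (LINT s|lborel. real (card {i \<in> I. a i < s}) * exp (- s))) I"
proof -
  let ?n = "\<lambda>s. card {i \<in> I. a i < s}"
  have "I = (\<Union>n::nat. {i \<in> I. a i < real n})"
    by (auto simp: reals_Archimedean2)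
  moreover have "countable (\<Union>n::nat. {i \<in> I. a i < real n})"
    using fin by (intro countable_UN) (auto intro: countable_finite)
  ultimately have cnt: "countable I" by simp
  interpret pair_sigma_finite "count_space I" lborel
    by (intro pair_sigma_finite.intro sigma_finite_measure_count_space_countable cnt sigma_finite_lborel)
  have "(\<integral>\<^sup>+i. ennreal (exp (- a i)) \<partial>count_space I) =
        (\<integral>\<^sup>+i. (\<integral>\<^sup>+s. ennreal (exp (- s)) * indicator {a i<..} s \<partial>lborel) \<partial>count_space I)"
    by (intro nn_integral_cong) (simp add: exp_eq_nn_integral_tail a)
  also have "\<dots> = (\<integral>\<^sup>+s. (\<integral>\<^sup>+i. ennreal (exp (- s)) * indicator {a i<..} s \<partial>count_space I) \<partial>lborel)"
    by (rule Fubini'[symmetric]) (auto intro!: measurable_pair_measure_countable1 cnt)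
  also have "\<dots> = (\<integral>\<^sup>+s. ennreal (real (?n s) * exp (- s)) \<partial>lborel)"
  proof (rule nn_integral_cong)
    fix s :: real
    have "(\<integral>\<^sup>+i. ennreal (exp (- s)) * indicator {a i<..} s \<partial>count_space I) =
          (\<Sum>i\<in>{i \<in> I. a i < s}. ennreal (exp (- s)) * indicator {a i<..} s)"
      by (rule nn_integral_count_space') (auto simp: fin)
    also have "\<dots> = (\<Sum>i\<in>{i \<in> I. a i < s}. ennreal (exp (- s)))"
      by (intro sum.cong) auto
    also have "\<dots> = ennreal (real (?n s) * exp (- s))"
      by (simp add: ennreal_mult ennreal_of_nat_eq_real_of_nat)
    finally show "(\<integral>\<^sup>+i. ennreal (exp (- s)) * indicator {a i<..} s \<partial>count_space I) =
      ennreal (real (?n s) * exp (- s))" .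
  qed
  also have "\<dots> = ennreal (LINT s|lborel. real (?n s) * exp (- s))"
    by (intro nn_integral_eq_integral int) auto
  finally have "has_bochner_integral (count_space I) (\<lambda>i. exp (- a i)) (LINT s|lborel. real (?n s) * exp (- s))"
    by (intro has_bochner_integral_nn_integral) (auto intro!: integral_nonneg_AE)
  then have s: "Infinite_Set_Sum.abs_summable_on (\<lambda>i. exp (- a i)) I"
    and eq: "infsetsum (\<lambda>i. exp (- a i)) I = (LINT s|lborel. real (?n s) * exp (- s))"
    by (auto simp: Infinite_Set_Sum.abs_summable_on_def infsetsum_def has_bochner_integral_iff)
  from s have "(\<lambda>i. exp (- a i)) summable_on I"
    using abs_summable_equivalent abs_summable_summable by blast
  then show ?thesis using infsetsum_infsum[OF s] eq by (metis has_sum_infsum)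
qed

lemma mat_act_divide: "mat_act g (z / of_real R) = mat_act g z / of_real R"
  using linear_scale[OF linear_mat_act[of g], of "1 / R" z] by (simp add: scaleR_conv_of_real)

text \<open>
  What the counting hypothesis says about \<open>\<Pi>(q)\<close>, for an indexed family of vectors in place of a set
  with multiplicities.
\<close>

locale ellipse_asymptotics =
  fixes I :: "'i set" and V :: "'i \<Rightarrow> complex" and c :: real
  assumes finite_ellipse: "\<And>g R. det g = 1 \<Longrightarrow> finite {i \<in> I. cmod (mat_act g (V i)) < R}"
    and ellipse_count: "\<And>g. det g = 1 \<Longrightarrow>
      ((\<lambda>R. real (card {i \<in> I. cmod (mat_act g (V i)) < R}) / R\<^sup>2) \<longlongrightarrow> c * pi) at_top"
begin

text \<open>
  Needed to dominate the layer cake integrands: the quotient by \<open>R\<^sup>2\<close> is bounded for large \<open>R\<close>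
  only, and the 1 accounts for small \<open>R\<close>.
\<close>

lemma ellipse_count_bound:
  assumes g: "det g = 1"
  shows "\<exists>K\<ge>0. \<forall>R\<ge>0. real (card {i \<in> I. cmod (mat_act g (V i)) < R}) \<le> K * (R\<^sup>2 + 1)"
proof -
  let ?n = "\<lambda>R. real (card {i \<in> I. cmod (mat_act g (V i)) < R})"
  have "\<forall>\<^sub>F R in at_top. ?n R / R\<^sup>2 < c * pi + 1"
    using order_tendstoD(2)[OF ellipse_count[OF g]] by simp
  then obtain R0 where R0: "\<And>R. R \<ge> R0 \<Longrightarrow> ?n R / R\<^sup>2 < c * pi + 1"
    by (auto simp: eventually_at_top_linorder)
  define r where "r = max R0 1"
  define K where "K = max (c * pi + 1) (?n r)"
  have K: "K \<ge> 0" by (auto simp: K_def max_def)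
  moreover have "?n R \<le> K * (R\<^sup>2 + 1)" if "R \<ge> 0" for R
  proof (cases "R \<ge> r")
    case True
    then have "R > 0" "?n R / R\<^sup>2 < c * pi + 1" using R0[of R] by (auto simp: r_def)
    then have "?n R \<le> (c * pi + 1) * R\<^sup>2" by (simp add: field_simps)
    also have "\<dots> \<le> K * R\<^sup>2" by (intro mult_right_mono) (auto simp: K_def)
    also have "\<dots> \<le> K * (R\<^sup>2 + 1)" using K by (intro mult_left_mono) auto
    finally show ?thesis .
  next
    case False
    then have "?n R \<le> ?n r" using finite_ellipse[OF g] by (auto intro!: card_mono)
    also have "\<dots> \<le> K * 1" by (simp add: K_def)
    also have "\<dots> \<le> K * (R\<^sup>2 + 1)" using K by (intro mult_left_mono) auto
    finally show ?thesis .
  qed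
  ultimately show ?thesis by blast
qed

text \<open>
  By the layer cake formula the sum is \<open>\<integral> e\<^sup>-\<^sup>s n(R sqrt (s/l)) ds\<close>, where \<open>n\<close> counts the vectors
  in an ellipse. After division by \<open>R\<^sup>2\<close> the integrand tends to \<open>e\<^sup>-\<^sup>s c \<pi> s/l\<close>, whose integral
  is \<open>c \<pi>/l\<close>, that is, \<open>c\<close> times the integral of the Gaussian.
\<close>

lemma radial_gaussian_asymptotics:
  assumes g: "det g = 1" and l: "l > 0"
  shows "\<And>R. R > 0 \<Longrightarrow> (\<lambda>i. exp (- l * (cmod (mat_act g (V i / of_real R)))\<^sup>2)) summable_on I"
    and "((\<lambda>R. (\<Sum>\<^sub>\<infinity>i\<in>I. exp (- l * (cmod (mat_act g (V i / of_real R)))\<^sup>2)) / R\<^sup>2) \<longlongrightarrow> c * (pi / l)) at_top"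
proof -
  let ?n = "\<lambda>R. real (card {i \<in> I. cmod (mat_act g (V i)) < R})"
  define a where "a = (\<lambda>R i. l * (cmod (mat_act g (V i / of_real R)))\<^sup>2)"
  define m where "m = (\<lambda>R s. real (card {i \<in> I. a R i < s}))"
  obtain K where K: "K \<ge> 0" "\<And>R. R \<ge> 0 \<Longrightarrow> ?n R \<le> K * (R\<^sup>2 + 1)"
    using ellipse_count_bound[OF g] by blast
  have iff: "a R i < s \<longleftrightarrow> cmod (mat_act g (V i)) < R * sqrt (s / l)" if "R > 0" "s > 0" for R i s
  proof -
    have "a R i = l * (cmod (mat_act g (V i)) / R)\<^sup>2"
      using that by (simp add: a_def mat_act_divide norm_divide)
    then have "a R i < s \<longleftrightarrow> (cmod (mat_act g (V i)) / R)\<^sup>2 < s / l"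
      using l by (simp add: field_simps)
    also have "\<dots> \<longleftrightarrow> cmod (mat_act g (V i)) / R < sqrt (s / l)"
      using that l by (smt (verit) divide_nonneg_nonneg norm_ge_zero real_less_rsqrt real_sqrt_less_iff real_sqrt_unique)
    finally show ?thesis using that by (simp add: field_simps)
  qed
  have a0: "a R i \<ge> 0" for R i using l by (simp add: a_def)
  have empty: "{i \<in> I. a R i < s} = {}" if "s \<le> 0" for R s
    using a0[of R] that by (auto simp: not_less intro: order_trans)
  then have m0: "m R s = 0" if "s \<le> 0" for R s
    using that by (simp only: m_def) simp
  have m_eq: "m R s = ?n (R * sqrt (s / l))" if "R > 0" "s > 0" for R s
    using iff[OF that] by (simp add: m_def)
  have fin: "finite {i \<in> I. a R i < s}" if "R > 0" for R s
  proof (cases "s > 0")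
    case True
    then show ?thesis using iff[OF that True] finite_ellipse[OF g] by simp
  next
    case False
    then have "{i \<in> I. a R i < s} = {}" using empty by simp
    then show ?thesis by (simp only: finite.emptyI)
  qed
  have meas: "m R \<in> borel_measurable borel" if "R > 0" for R
    unfolding m_def by (intro borel_measurable_mono) (auto intro!: monoI card_mono fin that)
  have bound: "m R s \<le> indicator {0..} s * (K * (R\<^sup>2 * (s / l) + 1))" if "R > 0" for R s
  proof (cases "s > 0")
    case True
    then have "m R s \<le> K * ((R * sqrt (s / l))\<^sup>2 + 1)"
      using m_eq K(2)[of "R * sqrt (s / l)"] that l by auto
    then show ?thesis using True l by (simp add: power_mult_distrib)
  next
    case False
    then show ?thesis using m0 K(1) l by (auto simp: indicator_def)
  qed
  have pow: "has_bochner_integral lborel (\<lambda>s. indicator {0..} s * (s ^ k * exp (- s))) (fact k :: real)" for k :: nat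
  proof (rule has_bochner_integral_nn_integral)
    show "(\<integral>\<^sup>+s. ennreal (indicator {0..} s * (s ^ k * exp (- s))) \<partial>lborel) = ennreal (fact k)"
      using nn_intergal_power_times_exp_Ici[of k]
      by (auto simp: mult.commute ennreal_mult' ennreal_indicator intro!: trans[OF nn_integral_cong] split: split_indicator)
  qed (auto simp: indicator_def)
  define w where "w = (\<lambda>R s. indicator {0..} s * (K * (R\<^sup>2 * (s / l) + 1)) * exp (- s))"
  have w: "integrable lborel (w R)" for R
  proof -
    have "integrable lborel (\<lambda>s. K * R\<^sup>2 / l * (indicator {0..} s * (s ^ 1 * exp (- s))) + K * (indicator {0..} s * (s ^ 0 * exp (- s))))"
      using pow[of 0] pow[of 1] by (intro Bochner_Integration.integrable_add integrable_mult_right) (auto simp: has_bochner_integral_iff)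
    then show ?thesis by (simp add: w_def algebra_simps)
  qed
  have mw: "\<bar>m R s * exp (- s)\<bar> \<le> w R s" if "R > 0" for R s
    using mult_right_mono[OF bound[OF that, of s], of "exp (- s)"] by (simp add: w_def m_def abs_mult)
  define F where "F = (\<lambda>s. indicator {0..} s * (c * pi * (s / l)) * exp (- s))"
  have F: "integral\<^sup>L lborel F = c * (pi / l)"
  proof -
    have "F = (\<lambda>s. c * pi / l * (indicator {0..} s * (s ^ 1 * exp (- s))))"
      by (auto simp: F_def)
    then show ?thesis using pow[of 1] by (simp add: has_bochner_integral_iff)
  qed
  have lim: "((\<lambda>R. m R s / R\<^sup>2 * exp (- s)) \<longlongrightarrow> F s) at_top" for s
  proof (cases "s > 0")
    case True
    define k where "k = sqrt (s / l)"
    have k: "k > 0" "k\<^sup>2 = s / l" using True l by (auto simp: k_def)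
    have "filterlim (\<lambda>R. R * k) at_top at_top" using k(1)
      by (intro filterlim_at_top_mult_tendsto_pos[OF tendsto_const] filterlim_ident)
    from filterlim_compose[OF ellipse_count[OF g] this]
    have "((\<lambda>R. ?n (R * k) / (R * k)\<^sup>2 * k\<^sup>2 * exp (- s)) \<longlongrightarrow> c * pi * k\<^sup>2 * exp (- s)) at_top"
      by (intro tendsto_intros)
    moreover have "\<forall>\<^sub>F R in at_top. ?n (R * k) / (R * k)\<^sup>2 * k\<^sup>2 * exp (- s) = m R s / R\<^sup>2 * exp (- s)"
      using eventually_gt_at_top[of 0]
    proof eventually_elim
      case (elim R)
      then show ?case using m_eq[of R s] True k(1) by (simp add: k_def[symmetric] power_mult_distrib)
    qed
    ultimately have "((\<lambda>R. m R s / R\<^sup>2 * exp (- s)) \<longlongrightarrow> c * pi * k\<^sup>2 * exp (- s)) at_top"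
      by (rule Lim_transform_eventually)
    then show ?thesis using True k(2) by (simp add: F_def)
  next
    case False
    then show ?thesis using m0 by (auto simp: F_def indicator_def)
  qed
  \<comment> \<open>Dominated convergence asks for measurability at all \<open>R\<close>. The sets counted by \<open>m R\<close> are
    known to be finite, which makes \<open>m R\<close> monotone, for positive \<open>R\<close> only.\<close>
  let ?s = "\<lambda>R s. if R > 0 then m R s / R\<^sup>2 * exp (- s) else 0"
  have s_meas: "?s R \<in> borel_measurable lborel" for R
    using meas[of R] by (cases "R > 0") auto
  have s_bound: "norm (?s R s) \<le> w 1 s" if "R \<ge> 1" for R s
  proof -
    have "w R s / R\<^sup>2 \<le> w 1 s"
    proof -
      have "K * 1 \<le> K * R\<^sup>2" using K(1) that by (intro mult_left_mono one_le_power)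
      then have "K * (R\<^sup>2 * (s / l) + 1) / R\<^sup>2 \<le> K * (1\<^sup>2 * (s / l) + 1)"
        using that by (simp add: field_simps)
      then have "indicator {0..} s * exp (- s) * (K * (R\<^sup>2 * (s / l) + 1) / R\<^sup>2) \<le>
          indicator {0..} s * exp (- s) * (K * (1\<^sup>2 * (s / l) + 1))"
        by (intro mult_left_mono) auto
      then show ?thesis by (simp add: w_def mult_ac)
    qed
    moreover have "norm (?s R s) = \<bar>m R s * exp (- s)\<bar> / R\<^sup>2" using that by (simp add: abs_mult)
    moreover have "\<bar>m R s * exp (- s)\<bar> / R\<^sup>2 \<le> w R s / R\<^sup>2" using mw[of R s] that by (intro divide_right_mono) auto
    ultimately show ?thesis by linarith
  qed
  have "((\<lambda>R. integral\<^sup>L lborel (?s R)) \<longlongrightarrow> integral\<^sup>L lborel F) at_top"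
  proof (rule integral_dominated_convergence_at_top)
    show "F \<in> borel_measurable lborel" by (simp add: F_def)
    show "AE s in lborel. ((\<lambda>R. ?s R s) \<longlongrightarrow> F s) at_top"
    proof (intro always_eventually allI)
      fix s
      show "((\<lambda>R. ?s R s) \<longlongrightarrow> F s) at_top"
        by (rule Lim_transform_eventually[OF lim])
          (use eventually_gt_at_top[of 0] in eventually_elim, simp)
    qed
    show "\<forall>\<^sub>F R in at_top. AE s in lborel. norm (?s R s) \<le> w 1 s"
      using eventually_ge_at_top[of 1] by eventually_elim (use s_bound in auto)
  qed (use s_meas w in auto)
  have int: "integrable lborel (\<lambda>s. m R s * exp (- s))" if "R > 0" for R
    by (rule Bochner_Integration.integrable_bound[OF w[of R]])
      (use meas[OF that] mw[OF that] in \<open>auto intro: order_trans[OF _ abs_ge_self]\<close>)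
  have hs: "((\<lambda>i. exp (- a R i)) has_sum (LINT s|lborel. m R s * exp (- s))) I" if "R > 0" for R
    unfolding m_def by (rule layer_cake_exp) (use a0 fin[OF that] int[OF that] in \<open>auto simp: m_def\<close>)
  show "(\<lambda>i. exp (- l * (cmod (mat_act g (V i / of_real R)))\<^sup>2)) summable_on I" if "R > 0" for R
    using hs[OF that] by (auto simp: a_def summable_on_def)
  have "\<forall>\<^sub>F R in at_top. integral\<^sup>L lborel (?s R) =
    (\<Sum>\<^sub>\<infinity>i\<in>I. exp (- l * (cmod (mat_act g (V i / of_real R)))\<^sup>2)) / R\<^sup>2"
    using eventually_gt_at_top[of 0]
  proof eventually_elim
    case (elim R)
    have "integral\<^sup>L lborel (?s R) = (LINT s|lborel. m R s * exp (- s)) / R\<^sup>2"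
      using elim by simp
    then show ?case using infsumI[OF hs[OF elim]] by (simp add: a_def)
  qed
  then show "((\<lambda>R. (\<Sum>\<^sub>\<infinity>i\<in>I. exp (- l * (cmod (mat_act g (V i / of_real R)))\<^sup>2)) / R\<^sup>2) \<longlongrightarrow> c * (pi / l)) at_top"
    using Lim_transform_eventually[OF \<open>((\<lambda>R. integral\<^sup>L lborel (?s R)) \<longlongrightarrow> integral\<^sup>L lborel F) at_top\<close>] F by simp
qed

end

definition gaussian :: "real \<Rightarrow> real \<Rightarrow> real \<Rightarrow> complex \<Rightarrow> real" where
  "gaussian a b d z = exp (- (a * (Re z)\<^sup>2 + 2 * b * (Re z * Im z) + d * (Im z)\<^sup>2))"

lemma continuous_on_gaussian: "continuous_on A (gaussian a b d)"
  unfolding gaussian_def[abs_def] by (intro continuous_intros)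

definition pos_form :: "real \<Rightarrow> real \<Rightarrow> real \<Rightarrow> bool" where
  "pos_form a b d \<longleftrightarrow> a > 0 \<and> d > 0 \<and> b\<^sup>2 < a * d"

text \<open>
  Completing the square: \<open>Q = sqrt (det Q) |g z|\<^sup>2\<close> with an upper triangular \<open>g\<close> of determinant 1.
\<close>

lemma gaussian_eq_radial:
  assumes "pos_form a b d"
  shows "\<exists>g. det g = 1 \<and> (\<forall>z. gaussian a b d z = exp (- sqrt (a * d - b\<^sup>2) * (cmod (mat_act g z))\<^sup>2))"
proof -
  define l where "l = sqrt (a * d - b\<^sup>2)"
  have p: "a > 0" "b\<^sup>2 < a * d" and l: "l > 0" "l\<^sup>2 = a * d - b\<^sup>2"
    using assms by (auto simp: pos_form_def l_def)
  define \<alpha> where "\<alpha> = sqrt (a / l)"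
  have \<alpha>: "\<alpha> > 0" "\<alpha>\<^sup>2 = a / l" using p l by (auto simp: \<alpha>_def)
  define g :: "real^2^2" where "g = vector [vector [\<alpha>, b / (l * \<alpha>)], vector [0, 1 / \<alpha>]]"
  have gs: "vec_nth (vec_nth g 1) 1 = \<alpha>" "vec_nth (vec_nth g 1) 2 = b / (l * \<alpha>)"
    "vec_nth (vec_nth g 2) 1 = 0" "vec_nth (vec_nth g 2) 2 = 1 / \<alpha>"
    by (simp_all add: g_def vector_2)
  have "det g = 1" using \<alpha> by (simp add: det_2 gs)
  moreover have "gaussian a b d z = exp (- l * (cmod (mat_act g z))\<^sup>2)" for z
  proof -
    define x y where "x = Re z" "y = Im z"
    have "(cmod (mat_act g z))\<^sup>2 = (\<alpha> * x + b / (l * \<alpha>) * y)\<^sup>2 + (1 / \<alpha> * y)\<^sup>2"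
      by (simp add: cmod_power2 mat_act_def gs x_y_def)
    also have "\<dots> = \<alpha>\<^sup>2 * x\<^sup>2 + 2 * b / l * (x * y) + (b\<^sup>2 / l\<^sup>2 + 1) / \<alpha>\<^sup>2 * y\<^sup>2"
      using \<alpha>(1) l(1) by (simp add: field_simps power2_eq_square)
    also have "l * \<dots> = a * x\<^sup>2 + 2 * b * (x * y) + (b\<^sup>2 + l\<^sup>2) / a * y\<^sup>2"
      unfolding \<alpha>(2) using l(1) p(1) by (simp add: field_simps power2_eq_square)
    also have "(b\<^sup>2 + l\<^sup>2) / a = d" unfolding l(2) using p(1) by simp
    finally have "l * (cmod (mat_act g z))\<^sup>2 = a * x\<^sup>2 + 2 * b * (x * y) + d * y\<^sup>2" .
    then show ?thesis by (simp add: gaussian_def x_y_def)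
  qed
  ultimately show ?thesis unfolding l_def by blast
qed

lemma lborel_complex:
  "(lborel :: complex measure) = distr (lborel \<Otimes>\<^sub>M lborel) borel (\<lambda>(x, y). Complex x y)"
proof (rule lborel_eqI)
  fix l u :: complex
  assume "\<And>b. b \<in> Basis \<Longrightarrow> l \<bullet> b \<le> u \<bullet> b"
  from this[of 1] this[of \<i>] have le: "Re l \<le> Re u" "Im l \<le> Im u" by (auto simp: Basis_complex_def)
  have [measurable]: "(\<lambda>(x, y). Complex x y) \<in> borel_measurable (lborel \<Otimes>\<^sub>M lborel)"
    unfolding Complex_eq by measurable
  have "(\<lambda>(x, y). Complex x y) -` box l u = {Re l<..<Re u} \<times> {Im l<..<Im u}"
    by (auto simp: box_def Basis_complex_def)
  then have "emeasure (distr (lborel \<Otimes>\<^sub>M lborel) borel (\<lambda>(x, y). Complex x y)) (box l u) =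
      emeasure (lborel \<Otimes>\<^sub>M lborel) ({Re l<..<Re u} \<times> {Im l<..<Im u})"
    by (subst emeasure_distr) (auto simp: space_pair_measure)
  also have "\<dots> = (\<Prod>b\<in>Basis. (u - l) \<bullet> b)"
    using le by (subst lborel.emeasure_pair_measure_Times) (auto simp: Basis_complex_def ennreal_mult)
  finally show "emeasure (distr (lborel \<Otimes>\<^sub>M lborel) borel (\<lambda>(x, y). Complex x y)) (box l u) =
    (\<Prod>b\<in>Basis. (u - l) \<bullet> b)" .
qed simp

lemma nn_integral_gaussian_line:
  assumes "a > 0"
  shows "(\<integral>\<^sup>+x. ennreal (exp (- (a * (x + t)\<^sup>2))) \<partial>lborel) = ennreal (sqrt (pi / a))"
proof -
  define \<sigma> where "\<sigma> = sqrt (1 / (2 * a))"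
  have \<sigma>: "\<sigma> > 0" "\<sigma>\<^sup>2 = 1 / (2 * a)" using assms by (auto simp: \<sigma>_def)
  have "exp (- (a * (x + t)\<^sup>2)) = sqrt (pi / a) * normal_density (- t) \<sigma> x" for x
    using assms by (simp add: normal_density_def \<sigma>(2) field_simps)
  then have "(\<integral>\<^sup>+x. ennreal (exp (- (a * (x + t)\<^sup>2))) \<partial>lborel) =
      (\<integral>\<^sup>+x. ennreal (sqrt (pi / a)) * ennreal (normal_density (- t) \<sigma> x) \<partial>lborel)"
    using assms by (simp add: ennreal_mult)
  also have "\<dots> = ennreal (sqrt (pi / a)) * (\<integral>\<^sup>+x. ennreal (normal_density (- t) \<sigma> x) \<partial>lborel)"
    by (rule nn_integral_cmult) simp
  also have "(\<integral>\<^sup>+x. ennreal (normal_density (- t) \<sigma> x) \<partial>lborel) = 1"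
    using \<sigma>(1) by (subst nn_integral_eq_integral) auto
  finally show ?thesis by simp
qed

text \<open>
  Completing the square in the second variable splits the integral into two one-dimensional ones.
\<close>

lemma has_bochner_integral_gaussian:
  assumes "pos_form a b d"
  shows "has_bochner_integral lborel (gaussian a b d) (pi / sqrt (a * d - b\<^sup>2))"
proof (rule has_bochner_integral_nn_integral)
  define e where "e = a - b\<^sup>2 / d"
  have p: "a > 0" "d > 0" "e > 0" using assms by (auto simp: pos_form_def e_def field_simps)
  have [measurable]: "(\<lambda>(x, y). Complex x y) \<in> borel_measurable (lborel \<Otimes>\<^sub>M lborel)"
    unfolding Complex_eq by measurable
  show m[measurable]: "gaussian a b d \<in> borel_measurable lborel"
    by (simp add: borel_measurable_continuous_onI continuous_on_gaussian)
  have sq: "gaussian a b d (Complex x y) = exp (- (e * (x + 0)\<^sup>2)) * exp (- (d * (y + b * x / d)\<^sup>2))" for x y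
  proof -
    have "a * x\<^sup>2 + 2 * b * (x * y) + d * y\<^sup>2 = e * x\<^sup>2 + d * (y + b * x / d)\<^sup>2"
      using p by (simp add: e_def field_simps power2_eq_square)
    then show ?thesis by (simp add: gaussian_def flip: exp_add)
  qed
  have "(\<integral>\<^sup>+z. ennreal (gaussian a b d z) \<partial>lborel) =
    (\<integral>\<^sup>+p. ennreal (gaussian a b d (case p of (x, y) \<Rightarrow> Complex x y)) \<partial>(lborel \<Otimes>\<^sub>M lborel))"
    by (subst lborel_complex, subst nn_integral_distr) auto
  also have "\<dots> = (\<integral>\<^sup>+x. \<integral>\<^sup>+y. ennreal (gaussian a b d (Complex x y)) \<partial>lborel \<partial>lborel)"
    by (subst lborel.nn_integral_fst[symmetric]) auto
  also have "\<dots> = (\<integral>\<^sup>+x. ennreal (exp (- (e * (x + 0)\<^sup>2))) * ennreal (sqrt (pi / d)) \<partial>lborel)"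
    using p by (intro nn_integral_cong) (simp add: sq ennreal_mult nn_integral_cmult nn_integral_gaussian_line)
  also have "\<dots> = ennreal (sqrt (pi / e)) * ennreal (sqrt (pi / d))"
    by (subst nn_integral_multc) (simp_all only: nn_integral_gaussian_line[OF p(3)], simp)
  also have "\<dots> = ennreal (sqrt (pi / e) * sqrt (pi / d))"
    using p by (simp add: ennreal_mult)
  also have "sqrt (pi / e) * sqrt (pi / d) = pi / sqrt (a * d - b\<^sup>2)"
  proof -
    have "e * d = a * d - b\<^sup>2" using p by (simp add: e_def field_simps)
    then show ?thesis by (simp add: real_sqrt_divide flip: real_sqrt_mult)
  qed
  finally show "(\<integral>\<^sup>+z. ennreal (gaussian a b d z) \<partial>lborel) = ennreal (pi / sqrt (a * d - b\<^sup>2))" .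
qed (use assms in \<open>auto simp: gaussian_def pos_form_def\<close>)

section \<open>From Gaussians to even functions\<close>

context ellipse_asymptotics
begin

definition equidistributes :: "(complex \<Rightarrow> real) \<Rightarrow> bool" where
  "equidistributes f \<longleftrightarrow> integrable lborel f \<and>
     (\<forall>R>0. (\<lambda>i. f (V i / of_real R)) summable_on I) \<and>
     ((\<lambda>R. (\<Sum>\<^sub>\<infinity>i\<in>I. f (V i / of_real R)) / R\<^sup>2) \<longlongrightarrow> c * integral\<^sup>L lborel f) at_top"

lemma equidistributes_gaussian:
  assumes "pos_form a b d"
  shows "equidistributes (gaussian a b d)"
proof -
  obtain g where g: "det g = 1" "gaussian a b d = (\<lambda>z. exp (- sqrt (a * d - b\<^sup>2) * (cmod (mat_act g z))\<^sup>2))"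
    using gaussian_eq_radial[OF assms] by blast
  have "sqrt (a * d - b\<^sup>2) > 0" using assms by (simp add: pos_form_def)
  from radial_gaussian_asymptotics[OF g(1) this] has_bochner_integral_gaussian[OF assms]
  show ?thesis unfolding equidistributes_def
    by (auto simp: has_bochner_integral_iff g(2) simp del: mult_minus_left)
qed

lemma equidistributes_add:
  assumes "equidistributes f" "equidistributes h"
  shows "equidistributes (\<lambda>z. f z + h z)"
proof -
  have "((\<lambda>R. (\<Sum>\<^sub>\<infinity>i\<in>I. f (V i / of_real R)) / R\<^sup>2 + (\<Sum>\<^sub>\<infinity>i\<in>I. h (V i / of_real R)) / R\<^sup>2)
      \<longlongrightarrow> c * integral\<^sup>L lborel f + c * integral\<^sup>L lborel h) at_top"
    using assms by (intro tendsto_add) (auto simp: equidistributes_def)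
  moreover have "\<forall>\<^sub>F R in at_top. (\<Sum>\<^sub>\<infinity>i\<in>I. f (V i / of_real R)) / R\<^sup>2 + (\<Sum>\<^sub>\<infinity>i\<in>I. h (V i / of_real R)) / R\<^sup>2 =
      (\<Sum>\<^sub>\<infinity>i\<in>I. f (V i / of_real R) + h (V i / of_real R)) / R\<^sup>2"
    using eventually_gt_at_top[of 0]
    by eventually_elim (use assms in \<open>simp add: equidistributes_def infsum_add add_divide_distrib\<close>)
  ultimately have "((\<lambda>R. (\<Sum>\<^sub>\<infinity>i\<in>I. f (V i / of_real R) + h (V i / of_real R)) / R\<^sup>2)
      \<longlongrightarrow> c * integral\<^sup>L lborel f + c * integral\<^sup>L lborel h) at_top"
    by (rule Lim_transform_eventually)
  then show ?thesis using assms
    by (auto simp: equidistributes_def distrib_left intro!: summable_on_add)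
qed

lemma equidistributes_scale:
  assumes "equidistributes f"
  shows "equidistributes (\<lambda>z. k * f z)"
proof -
  have "((\<lambda>R. k * ((\<Sum>\<^sub>\<infinity>i\<in>I. f (V i / of_real R)) / R\<^sup>2)) \<longlongrightarrow> k * (c * integral\<^sup>L lborel f)) at_top"
    using assms by (intro tendsto_mult tendsto_const) (auto simp: equidistributes_def)
  then show ?thesis using assms
    by (auto simp: equidistributes_def infsum_cmult_right' mult_ac intro!: summable_on_cmult_right)
qed

text \<open>
  Uniform approximation alone would not pass to the sums over an infinite family; an error that is
  small relative to a function \<open>k\<close> for which the asymptotics hold does.
\<close>

lemma equidistributes_closed:
  assumes k: "equidistributes k" and f: "f \<in> borel_measurable lborel"
    and approx: "\<And>\<epsilon>. \<epsilon> > 0 \<Longrightarrow> \<exists>h. equidistributes h \<and> (\<forall>z. \<bar>f z - h z\<bar> \<le> \<epsilon> * k z)"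
  shows "equidistributes f"
proof -
  define S where "S = (\<lambda>R f. (\<Sum>\<^sub>\<infinity>i\<in>I. f (V i / of_real R)) / R\<^sup>2)" for R :: real and f :: "complex \<Rightarrow> real"
  have k0: "k z \<ge> 0" for z
  proof -
    obtain h where "\<bar>f z - h z\<bar> \<le> 1 * k z" using approx[of 1] by auto
    then show ?thesis by linarith
  qed
  have int: "integrable lborel f" and sum: "\<And>R. R > 0 \<Longrightarrow> (\<lambda>i. f (V i / of_real R)) summable_on I"
  proof -
    obtain h where h: "equidistributes h" "\<And>z. \<bar>f z - h z\<bar> \<le> 1 * k z" using approx[of 1] by auto
    have le: "\<bar>f z\<bar> \<le> \<bar>h z\<bar> + k z" for z using h(2)[of z] by linarith
    have "integrable lborel (\<lambda>z. \<bar>h z\<bar> + k z)"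
      using h(1) k by (auto simp: equidistributes_def)
    then show "integrable lborel f"
      by (rule Bochner_Integration.integrable_bound[OF _ f]) (auto intro!: always_eventually order_trans[OF le])
    fix R :: real assume "R > 0"
    then have "(\<lambda>i. \<bar>h (V i / of_real R)\<bar> + k (V i / of_real R)) summable_on I"
      using h(1) k summable_on_iff_abs_summable_on_real[of "\<lambda>i. h (V i / of_real R)" I]
      by (intro summable_on_add) (auto simp: equidistributes_def)
    then have "(\<lambda>i. norm (f (V i / of_real R))) summable_on I"
      by (rule Infinite_Sum.abs_summable_on_comparison_test') (use le in auto)
    then show "(\<lambda>i. f (V i / of_real R)) summable_on I"
      using summable_on_iff_abs_summable_on_real by blast
  qed
  have "((\<lambda>R. S R f) \<longlongrightarrow> c * integral\<^sup>L lborel f) at_top"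
  proof (rule tendstoI)
    fix \<eta> :: real assume \<eta>: "\<eta> > 0"
    define A where "A = \<bar>c * integral\<^sup>L lborel k\<bar> + 1"
    have A: "A > 0" by (simp add: A_def)
    define \<epsilon> where "\<epsilon> = \<eta> / (4 * A)"
    have \<epsilon>: "\<epsilon> > 0" "\<epsilon> * A = \<eta> / 4" using \<eta> A by (auto simp: \<epsilon>_def)
    obtain h where h: "equidistributes h" "\<And>z. \<bar>f z - h z\<bar> \<le> \<epsilon> * k z" using approx[OF \<epsilon>(1)] by auto
    have 1: "\<forall>\<^sub>F R in at_top. \<bar>S R h - c * integral\<^sup>L lborel h\<bar> < \<eta> / 4"
      using h(1) \<eta> tendstoD[of "\<lambda>R. S R h" _ at_top "\<eta> / 4"] by (simp add: S_def equidistributes_def dist_real_def)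
    have 2: "\<forall>\<^sub>F R in at_top. S R k < A"
      using k by (intro order_tendstoD(2)[of _ "c * integral\<^sup>L lborel k"]) (auto simp: S_def equidistributes_def A_def)
    have 3: "\<bar>c * integral\<^sup>L lborel h - c * integral\<^sup>L lborel f\<bar> \<le> \<eta> / 4"
    proof -
      have hi: "integrable lborel h" and ki: "integrable lborel k"
        using h(1) k by (auto simp: equidistributes_def)
      have "\<bar>integral\<^sup>L lborel f - integral\<^sup>L lborel h\<bar> = \<bar>LINT z|lborel. f z - h z\<bar>"
        using int hi by simp
      also have "\<dots> \<le> (LINT z|lborel. \<epsilon> * k z)"
        using int hi ki h(2) by (intro integral_abs_bound[THEN order_trans] integral_mono) auto
      also have "\<dots> = \<epsilon> * integral\<^sup>L lborel k" by simp
      finally have "\<bar>c\<bar> * \<bar>integral\<^sup>L lborel f - integral\<^sup>L lborel h\<bar> \<le> \<bar>c\<bar> * (\<epsilon> * integral\<^sup>L lborel k)"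
        by (intro mult_left_mono) auto
      also have "\<dots> = \<epsilon> * \<bar>c * integral\<^sup>L lborel k\<bar>"
        using k0 by (simp add: abs_mult)
      also have "\<dots> \<le> \<epsilon> * A" using \<epsilon>(1) by (intro mult_left_mono) (auto simp: A_def)
      finally show ?thesis
        using \<epsilon>(2) abs_minus_commute[of "integral\<^sup>L lborel f"] by (simp flip: abs_mult right_diff_distrib)
    qed
    show "\<forall>\<^sub>F R in at_top. dist (S R f) (c * integral\<^sup>L lborel f) < \<eta>"
      using 1 2 eventually_gt_at_top[of 0]
    proof eventually_elim
      case (elim R)
      have hs: "(\<lambda>i. h (V i / of_real R)) summable_on I" "(\<lambda>i. k (V i / of_real R)) summable_on I"
        using h(1) k elim by (auto simp: equidistributes_def)
      have "((\<lambda>i. f (V i / of_real R) - h (V i / of_real R)) has_sum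
          (\<Sum>\<^sub>\<infinity>i\<in>I. f (V i / of_real R)) - (\<Sum>\<^sub>\<infinity>i\<in>I. h (V i / of_real R))) I"
        using has_sum_add[OF has_sum_infsum[OF sum[OF elim(3)]] has_sum_uminusI[OF has_sum_infsum[OF hs(1)]]] by simp
      from norm_infsum_le[OF this has_sum_cmult_right[OF has_sum_infsum[OF hs(2)], of \<epsilon>]]
      have "\<bar>(\<Sum>\<^sub>\<infinity>i\<in>I. f (V i / of_real R)) - (\<Sum>\<^sub>\<infinity>i\<in>I. h (V i / of_real R))\<bar>
          \<le> \<epsilon> * (\<Sum>\<^sub>\<infinity>i\<in>I. k (V i / of_real R))"
        using h(2) by simp
      then have "\<bar>(\<Sum>\<^sub>\<infinity>i\<in>I. f (V i / of_real R)) - (\<Sum>\<^sub>\<infinity>i\<in>I. h (V i / of_real R))\<bar> / R\<^sup>2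
          \<le> \<epsilon> * (\<Sum>\<^sub>\<infinity>i\<in>I. k (V i / of_real R)) / R\<^sup>2"
        by (intro divide_right_mono) auto
      then have "\<bar>S R f - S R h\<bar> \<le> \<epsilon> * S R k"
        by (simp add: S_def diff_divide_distrib[symmetric])
      also have "\<dots> \<le> \<epsilon> * A" using elim(2) \<epsilon>(1) by (intro mult_left_mono) auto
      finally have "\<bar>S R f - S R h\<bar> \<le> \<eta> / 4" using \<epsilon>(2) by simp
      then show ?case unfolding dist_real_def using 3 elim(1) \<eta> by linarith
    qed
  qed
  then show ?thesis using int sum by (simp add: equidistributes_def S_def)
qed

end

text \<open>
  The linear span of the Gaussians. Its only constant is 0, but it is a module over the algebra
  generated by the constants and the Gaussians.
\<close>

inductive gaussian_span :: "(complex \<Rightarrow> real) \<Rightarrow> bool" where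
  gaussian: "pos_form a b d \<Longrightarrow> gaussian_span (gaussian a b d)"
| add: "gaussian_span f \<Longrightarrow> gaussian_span h \<Longrightarrow> gaussian_span (\<lambda>z. f z + h z)"
| scale: "gaussian_span f \<Longrightarrow> gaussian_span (\<lambda>z. k * f z)"

lemma (in ellipse_asymptotics) equidistributes_gaussian_span: "gaussian_span f \<Longrightarrow> equidistributes f"
  by (induction rule: gaussian_span.induct)
    (auto intro: equidistributes_gaussian equidistributes_add equidistributes_scale)

text \<open>
  The sum of positive definite forms is positive definite. In terms of coefficients the mixed term is
  handled by \<open>4 b\<^sup>2 b'\<^sup>2 \<le> 4 a d a' d' \<le> (a d' + a' d)\<^sup>2\<close>.
\<close>

lemma pos_form_add:
  assumes "pos_form a b d" "pos_form a' b' d'"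
  shows "pos_form (a + a') (b + b') (d + d')"
proof -
  have p: "a > 0" "d > 0" "b\<^sup>2 < a * d" "a' > 0" "d' > 0" "b'\<^sup>2 < a' * d'"
    using assms by (auto simp: pos_form_def)
  have "b\<^sup>2 * b'\<^sup>2 \<le> (a * d) * (a' * d')" using p by (intro mult_mono) auto
  then have "(2 * (b * b'))\<^sup>2 \<le> 4 * ((a * d') * (a' * d))"
    by (simp add: power_mult_distrib mult_ac)
  also have "\<dots> \<le> (a * d' + a' * d)\<^sup>2"
  proof -
    have "4 * (x * y) \<le> (x + y)\<^sup>2" for x y :: real
      using zero_le_power2[of "x - y"] by (simp add: power2_eq_square algebra_simps)
    then show ?thesis .
  qed
  finally have sq: "(2 * (b * b'))\<^sup>2 \<le> (a * d' + a' * d)\<^sup>2" .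
  have "0 \<le> a * d' + a' * d" using p by (intro add_nonneg_nonneg mult_nonneg_nonneg) linarith+
  with sq have "2 * (b * b') \<le> a * d' + a' * d" by (rule power2_le_imp_le)
  moreover have "(b + b')\<^sup>2 = b\<^sup>2 + 2 * (b * b') + b'\<^sup>2" by (simp add: power2_sum)
  moreover have "(a + a') * (d + d') = a * d + (a * d' + a' * d) + a' * d'" by (simp add: algebra_simps)
  ultimately have "(b + b')\<^sup>2 < (a + a') * (d + d')" using p by linarith
  then show ?thesis using p by (simp add: pos_form_def)
qed

lemma gaussian_mult: "gaussian a b d z * gaussian a' b' d' z = gaussian (a + a') (b + b') (d + d') z"
  by (simp add: gaussian_def algebra_simps flip: exp_add)

lemma gaussian_span_mult_gaussian:
  assumes "pos_form a b d" "gaussian_span f"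
  shows "gaussian_span (\<lambda>z. gaussian a b d z * f z)"
  using assms(2)
proof (induction rule: gaussian_span.induct)
  case (gaussian a' b' d')
  then have "gaussian_span (\<lambda>z. gaussian (a + a') (b + b') (d + d') z)"
    by (intro gaussian_span.gaussian pos_form_add assms(1))
  then show ?case unfolding gaussian_mult .
next
  case (add f h)
  show ?case unfolding distrib_left by (rule gaussian_span.add[OF add.IH])
next
  case (scale f k)
  show ?case unfolding mult.left_commute[of _ k] by (rule gaussian_span.scale[OF scale.IH])
qed

text \<open>
  With \<open>w = z\<^sup>2\<close> these are \<open>exp (- 2 |w|)\<close>, \<open>exp (- 2 |w| - Re w)\<close> and
  \<open>exp (- 2 |w| - Im w)\<close>. Quotients recover \<open>w\<close>, hence \<open>z\<close> up to sign, and all three tend to 0 at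
  infinity: the plane modulo sign, with a point at infinity, is embedded in a compact cube.
\<close>

definition gaussian_coords :: "complex \<Rightarrow> real \<times> real \<times> real" where
  "gaussian_coords z = (gaussian 2 0 2 z, gaussian 3 0 1 z, gaussian 2 1 2 z)"

lemma gaussian_span_mult_polynomial:
  assumes "real_polynomial_function p" "gaussian_span f"
  shows "gaussian_span (\<lambda>z. p (gaussian_coords z) * f z)"
  using assms
proof (induction arbitrary: f rule: real_polynomial_function.induct)
  case (linear h)
  have h: "h (x, y, w) = x * h (1, 0, 0) + (y * h (0, 1, 0) + w * h (0, 0, 1))" for x y w
  proof -
    have "(x, y, w) = x *\<^sub>R (1, 0, 0) + (y *\<^sub>R (0, 1, 0) + w *\<^sub>R (0, 0, 1))" by simp
    then show ?thesis
      using linear.hyps by (simp only: linear_simps[OF linear.hyps]) simp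
  qed
  have "gaussian_span (\<lambda>z. h (1, 0, 0) * (gaussian 2 0 2 z * f z) +
     (h (0, 1, 0) * (gaussian 3 0 1 z * f z) + h (0, 0, 1) * (gaussian 2 1 2 z * f z)))"
    by (intro gaussian_span.add gaussian_span.scale gaussian_span_mult_gaussian linear.prems)
      (auto simp: pos_form_def)
  then show ?case by (simp add: gaussian_coords_def h[of "gaussian _ _ _ _"] algebra_simps)
next
  case (const k)
  then show ?case by (rule gaussian_span.scale)
next
  case (add p q)
  show ?case unfolding distrib_right by (intro gaussian_span.add add.IH add.prems)
next
  case (mult p q)
  then show ?case using mult.IH(1)[OF mult.IH(2)[OF mult.prems]] by (simp add: mult.assoc)
qed

text \<open>
  On the branch cut \<open>csqrt\<close> can be replaced by the continuous root \<open>\<i> csqrt (- w)\<close>, which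
  differs from it by a sign only.
\<close>

lemma continuous_even_through_square:
  fixes \<psi> :: "complex \<Rightarrow> real"
  assumes \<psi>: "continuous_on UNIV \<psi>" and even: "\<And>z. \<psi> (- z) = \<psi> z"
  shows "continuous_on UNIV (\<lambda>w. \<psi> (csqrt w))" "\<psi> (csqrt (z\<^sup>2)) = \<psi> z"
proof -
  have eq: "\<psi> u = \<psi> v" if "u\<^sup>2 = v\<^sup>2" for u v using that even by (auto simp: power2_eq_iff)
  show "\<psi> (csqrt (z\<^sup>2)) = \<psi> z" by (rule eq) simp
  have cont: "isCont \<psi> z" for z using \<psi> by (simp add: continuous_on_eq_continuous_at)
  have "isCont (\<lambda>w. \<psi> (csqrt w)) w" for w
  proof (cases "w = 0")
    case True
    have "isCont csqrt 0"
    proof -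
      have "((\<lambda>w. sqrt (cmod w)) \<longlongrightarrow> sqrt (cmod 0)) (at 0)" by (intro tendsto_intros)
      then have "((\<lambda>w. norm (csqrt w)) \<longlongrightarrow> 0) (at 0)" by simp
      then have "(csqrt \<longlongrightarrow> 0) (at 0)" by (rule tendsto_norm_zero_cancel)
      then show ?thesis by (simp add: isCont_def)
    qed
    then have "isCont csqrt w" using True by simp
    then show ?thesis using cont by (rule isCont_o2)
  next
    case False
    show ?thesis
    proof (cases "w \<in> \<real>\<^sub>\<le>\<^sub>0")
      case False
      then have "isCont csqrt w" by (rule continuous_at_csqrt)
      then show ?thesis using cont by (rule isCont_o2)
    next
      case True
      then have "- w \<notin> \<real>\<^sub>\<le>\<^sub>0" using False by (auto simp: complex_nonpos_Reals_iff complex_eq_iff)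
      moreover have "isCont uminus w" by (intro continuous_intros)
      ultimately have "isCont (\<lambda>w. csqrt (- w)) w" by (rule isCont_csqrt'[rotated])
      then have "isCont (\<lambda>w. \<i> * csqrt (- w)) w" by (intro continuous_intros)
      then have "isCont (\<lambda>w. \<psi> (\<i> * csqrt (- w))) w" using cont by (rule isCont_o2)
      moreover have "(\<lambda>w. \<psi> (\<i> * csqrt (- w))) = (\<lambda>w. \<psi> (csqrt w))"
        by (intro ext eq) (simp add: power_mult_distrib)
      ultimately show ?thesis by simp
    qed
  qed
  then show "continuous_on UNIV (\<lambda>w. \<psi> (csqrt w))" by (simp add: continuous_on_eq_continuous_at)
qed

text \<open>
  The inverse of the embedding is given by logarithms of quotients, which are not defined on the whole
  space. They are truncated by \<open>\<delta>\<close>, and the cutoff \<open>\<kappa>\<close> in the first coordinate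
  \<open>exp (- 2 |w|)\<close> discards the points for which the truncation changes something.
\<close>

lemma continuous_even_through_gaussian_coords:
  fixes \<psi> :: "complex \<Rightarrow> real"
  assumes \<psi>: "continuous_on UNIV \<psi>" and even: "\<And>z. \<psi> (- z) = \<psi> z" and supp: "\<And>z. cmod z > B \<Longrightarrow> \<psi> z = 0"
  shows "\<exists>\<Phi>. continuous_on UNIV \<Phi> \<and> (\<forall>z. \<Phi> (gaussian_coords z) = \<psi> z)"
proof -
  define M where "M = (max B 0)\<^sup>2"
  \<comment> \<open>On \<open>|w| \<le> M\<close>, which contains the support, the cutoff is 1; for \<open>|w| \<ge> M + 1\<close> it is 0. The
    truncation has no effect on \<open>|w| \<le> M + 1\<close>, as all coordinates are at least \<open>exp (- 3 |w|)\<close>.\<close>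
  define t0 t1 \<delta> where "t0 = exp (- 2 * (M + 1))" "t1 = exp (- 2 * M)" "\<delta> = exp (- 3 * (M + 1))"
  define \<kappa> :: "real \<Rightarrow> real" where "\<kappa> = (\<lambda>t. max 0 (min 1 ((t - t0) / (t1 - t0))))"
  define \<phi> where "\<phi> = (\<lambda>w. \<psi> (csqrt w))"
  define \<Phi> :: "real \<times> real \<times> real \<Rightarrow> real" where "\<Phi> = (\<lambda>(t, s, r).
     \<kappa> t * \<phi> (Complex (- ln (max s \<delta> / max t \<delta>)) (- ln (max r \<delta> / max t \<delta>))))"
  have \<delta>: "\<delta> > 0" "t0 < t1" by (auto simp: t0_t1_\<delta>_def)
  have d: "max x \<delta> \<noteq> 0" "max x \<delta> > 0" for x using \<delta> by (auto simp: max_def)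
  have "continuous_on UNIV \<phi>"
    unfolding \<phi>_def by (rule continuous_even_through_square(1)[OF \<psi> even])
  moreover have "continuous_on UNIV (\<lambda>(t, s, r). Complex (- ln (max s \<delta> / max t \<delta>)) (- ln (max r \<delta> / max t \<delta>)))"
    unfolding case_prod_beta Complex_eq using d by (intro continuous_intros) (auto simp: less_imp_neq[symmetric])
  ultimately have "continuous_on UNIV (\<lambda>(t, s, r). \<phi> (Complex (- ln (max s \<delta> / max t \<delta>)) (- ln (max r \<delta> / max t \<delta>))))"
    unfolding case_prod_beta by (rule continuous_on_compose2) auto
  then have "continuous_on UNIV \<Phi>"
    unfolding \<Phi>_def \<kappa>_def case_prod_beta using \<delta> by (intro continuous_intros) auto
  moreover have "\<Phi> (gaussian_coords z) = \<psi> z" for z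
  proof -
    define w where "w = z\<^sup>2"
    have \<phi>w: "\<phi> w = \<psi> z"
      unfolding \<phi>_def w_def by (rule continuous_even_through_square(2)[OF \<psi> even])
    have w: "cmod w = (Re z)\<^sup>2 + (Im z)\<^sup>2" "Re w = (Re z)\<^sup>2 - (Im z)\<^sup>2" "Im w = 2 * (Re z * Im z)"
      by (auto simp: w_def norm_power cmod_power2 Re_power2 Im_power2)
    have E: "gaussian_coords z = (exp (- 2 * cmod w), exp (- 2 * cmod w - Re w), exp (- 2 * cmod w - Im w))"
      by (simp add: gaussian_coords_def gaussian_def w algebra_simps)
    have zero: "\<psi> z = 0" if "cmod w > M"
    proof -
      have "(max B 0)\<^sup>2 < (cmod z)\<^sup>2" using that by (simp add: M_def w_def norm_power)
      then have "max B 0 < cmod z" by (rule power_less_imp_less_base) simp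
      then show ?thesis by (intro supp) simp
    qed
    show ?thesis
    proof (cases "cmod w \<le> M + 1")
      case True
      have ge: "exp (- 2 * cmod w) \<ge> \<delta>" "exp (- 2 * cmod w - Re w) \<ge> \<delta>" "exp (- 2 * cmod w - Im w) \<ge> \<delta>"
        using True abs_Re_le_cmod[of w] abs_Im_le_cmod[of w] by (auto simp: t0_t1_\<delta>_def)
      have "\<Phi> (gaussian_coords z) = \<kappa> (exp (- 2 * cmod w)) * \<phi> (Complex (Re w) (Im w))"
        unfolding E \<Phi>_def prod.case max_absorb1[OF ge(1)] max_absorb1[OF ge(2)] max_absorb1[OF ge(3)]
        by (simp flip: exp_diff)
      also have "\<dots> = \<kappa> (exp (- 2 * cmod w)) * \<psi> z" by (simp add: \<phi>w)
      also have "\<dots> = \<psi> z"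
      proof (cases "cmod w \<le> M")
        case True
        then have "exp (- 2 * cmod w) \<ge> t1" by (simp add: t0_t1_\<delta>_def)
        then have "\<kappa> (exp (- 2 * cmod w)) = 1" using \<delta> by (simp add: \<kappa>_def min_def max_def)
        then show ?thesis by simp
      qed (simp add: zero)
      finally show ?thesis .
    next
      case False
      then have "exp (- 2 * cmod w) < t0" by (simp add: t0_t1_\<delta>_def)
      then have "(exp (- 2 * cmod w) - t0) / (t1 - t0) \<le> 0" using \<delta> by (intro divide_nonpos_pos) auto
      then have "\<kappa> (exp (- 2 * cmod w)) = 0" unfolding \<kappa>_def by (intro max_absorb1) (auto simp: min_le_iff_disj)
      then show ?thesis unfolding E \<Phi>_def using zero False by simp
    qed
  qed
  ultimately show ?thesis by blast
qed

context ellipse_asymptotics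
begin

text \<open>
  The factor \<open>exp (- |z|\<^sup>2)\<close> is split off before the polynomial approximation, so that what remains
  is an error relative to an integrable function, and so that constant polynomials are harmless.
\<close>

lemma equidistributes_even:
  assumes \<psi>: "continuous_on UNIV \<psi>" and even: "\<And>z. \<psi> (- z) = \<psi> z" and supp: "\<And>z. cmod z > B \<Longrightarrow> \<psi> z = 0"
  shows "equidistributes \<psi>"
proof (rule equidistributes_closed)
  have pf: "pos_form 1 0 1" by (simp add: pos_form_def)
  then show "equidistributes (gaussian 1 0 1)" by (rule equidistributes_gaussian)
  show "\<psi> \<in> borel_measurable lborel" using borel_measurable_continuous_onI[OF \<psi>] by simp
  let ?H = "\<lambda>z. \<psi> z / gaussian 1 0 1 z"
  have pos: "gaussian 1 0 1 z > 0" for z by (simp add: gaussian_def)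
  have "\<exists>\<Phi>. continuous_on UNIV \<Phi> \<and> (\<forall>z. \<Phi> (gaussian_coords z) = ?H z)"
  proof (rule continuous_even_through_gaussian_coords)
    show "continuous_on UNIV ?H"
      using pos by (intro continuous_intros \<psi> continuous_on_gaussian) (auto simp: less_imp_neq[symmetric])
    show "?H (- z) = ?H z" for z by (simp add: even gaussian_def)
    show "?H z = 0" if "cmod z > B" for z using supp[OF that] by simp
  qed
  then obtain \<Phi> where \<Phi>: "continuous_on UNIV \<Phi>" "\<And>z. \<Phi> (gaussian_coords z) = ?H z" by blast
  fix \<epsilon> :: real assume "\<epsilon> > 0"
  let ?K = "cbox (0, 0, 0) (1, 1, 1) :: (real \<times> real \<times> real) set"
  obtain p where p: "real_polynomial_function p" "\<And>x. x \<in> ?K \<Longrightarrow> \<bar>\<Phi> x - p x\<bar> < \<epsilon>"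
    using Stone_Weierstrass_real_polynomial_function[OF compact_cbox continuous_on_subset[OF \<Phi>(1)] \<open>\<epsilon> > 0\<close>]
    by (metis subset_UNIV)
  have K: "gaussian_coords z \<in> ?K" for z
  proof -
    have "2 * (Re z * Im z) \<ge> - ((Re z)\<^sup>2 + (Im z)\<^sup>2)"
      using zero_le_power2[of "Re z + Im z"] by (simp add: power2_sum)
    with zero_le_power2[of "Re z"] zero_le_power2[of "Im z"]
    have "gaussian 2 0 2 z \<le> 1" "gaussian 3 0 1 z \<le> 1" "gaussian 2 1 2 z \<le> 1"
      unfolding gaussian_def exp_le_one_iff by linarith+
    then show ?thesis by (simp add: gaussian_coords_def gaussian_def flip: cbox_Pair_eq)
  qed
  let ?h = "\<lambda>z. p (gaussian_coords z) * gaussian 1 0 1 z"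
  have "equidistributes ?h"
    by (intro equidistributes_gaussian_span gaussian_span_mult_polynomial p(1) gaussian_span.gaussian pf)
  moreover have "\<bar>\<psi> z - ?h z\<bar> \<le> \<epsilon> * gaussian 1 0 1 z" for z
  proof -
    have "\<psi> z - ?h z = (\<Phi> (gaussian_coords z) - p (gaussian_coords z)) * gaussian 1 0 1 z"
      using pos[of z] by (simp add: \<Phi>(2) field_simps)
    then show ?thesis using p(2)[OF K[of z]] pos[of z] by (simp add: abs_mult)
  qed
  ultimately show "\<exists>h. equidistributes h \<and> (\<forall>z. \<bar>\<psi> z - h z\<bar> \<le> \<epsilon> * gaussian 1 0 1 z)" by blast
qed

end

section \<open>Symmetrisation and conclusion\<close>

lemma integral_lborel_reflect:
  fixes f :: "complex \<Rightarrow> real"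
  assumes [measurable]: "f \<in> borel_measurable borel"
  shows "(LINT z|lborel. f (- z)) = integral\<^sup>L lborel f"
    and "integrable lborel (\<lambda>z. f (- z)) \<longleftrightarrow> integrable lborel f"
proof -
  have "lborel = density (distr lborel borel (\<lambda>z::complex. 0 + (-1) *\<^sub>R z)) (\<lambda>_. \<bar>-1::real\<bar> ^ DIM(complex))"
    by (rule lborel_affine) simp
  then have *: "distr lborel borel uminus = (lborel :: complex measure)"
    by (simp add: density_1 one_ennreal_def[symmetric])
  have "integral\<^sup>L (distr lborel borel uminus) f = (LINT z|lborel. f (- z))"
    by (rule integral_distr) auto
  then show "(LINT z|lborel. f (- z)) = integral\<^sup>L lborel f" unfolding * by simp
  have "integrable (distr lborel borel uminus) f \<longleftrightarrow> integrable lborel (\<lambda>z. f (- z))"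
    by (rule integrable_distr_eq) auto
  then show "integrable lborel (\<lambda>z. f (- z)) \<longleftrightarrow> integrable lborel f" unfolding * by simp
qed

context ellipse_asymptotics
begin

text \<open>
  A symmetric family does not distinguish a function from its even part. Summability and integrability
  cannot be read off from the even part; they come from the even function \<open>|\<psi>(z)| + |\<psi>(- z)|\<close>.
\<close>

lemma equidistributes_real:
  fixes \<psi> :: "complex \<Rightarrow> real"
  assumes \<sigma>: "bij_betw \<sigma> I I" "\<And>i. i \<in> I \<Longrightarrow> V (\<sigma> i) = - V i"
    and \<psi>: "continuous_on UNIV \<psi>" and supp: "\<And>z. cmod z > B \<Longrightarrow> \<psi> z = 0"
  shows "equidistributes \<psi>"
proof -
  let ?e = "\<lambda>z. 1 / 2 * (\<psi> z + \<psi> (- z))"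
  have neg: "continuous_on UNIV (\<lambda>z. \<psi> (- z))"
    by (rule continuous_on_compose2[OF \<psi>]) (auto intro!: continuous_intros)
  have m: "\<psi> \<in> borel_measurable borel" using \<psi> by (rule borel_measurable_continuous_onI)
  have abs: "equidistributes (\<lambda>z. \<bar>\<psi> z\<bar> + \<bar>\<psi> (- z)\<bar>)"
    by (rule equidistributes_even[where B = B]) (auto intro!: continuous_intros \<psi> neg simp: supp)
  have e: "equidistributes ?e"
    by (rule equidistributes_even[where B = B]) (auto intro!: continuous_intros \<psi> neg simp: supp)
  have int: "integrable lborel \<psi>"
    by (rule Bochner_Integration.integrable_bound[of _ "\<lambda>z. \<bar>\<psi> z\<bar> + \<bar>\<psi> (- z)\<bar>"])
      (use abs m in \<open>auto simp: equidistributes_def\<close>)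
  have sum: "(\<lambda>i. \<psi> (V i / of_real R)) summable_on I" if "R > 0" for R
  proof -
    have "(\<lambda>i. norm (\<psi> (V i / of_real R))) summable_on I"
      by (rule Infinite_Sum.abs_summable_on_comparison_test'[where g = "\<lambda>i. \<bar>\<psi> (V i / of_real R)\<bar> + \<bar>\<psi> (- (V i / of_real R))\<bar>"])
        (use abs that in \<open>auto simp: equidistributes_def\<close>)
    then show ?thesis using summable_on_iff_abs_summable_on_real by blast
  qed
  have reflect: "(\<lambda>i. \<psi> (- (V i / of_real R))) summable_on I"
     "(\<Sum>\<^sub>\<infinity>i\<in>I. \<psi> (- (V i / of_real R))) = (\<Sum>\<^sub>\<infinity>i\<in>I. \<psi> (V i / of_real R))" if "R > 0" for R
  proof -
    have eq: "\<psi> (V (\<sigma> i) / of_real R) = \<psi> (- (V i / of_real R))" if "i \<in> I" for i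
      using \<sigma>(2)[OF that] by simp
    have "(\<lambda>i. \<psi> (V (\<sigma> i) / of_real R)) summable_on I"
      using summable_on_reindex_bij_betw[OF \<sigma>(1), of "\<lambda>i. \<psi> (V i / of_real R)"] sum[OF that] by simp
    then show "(\<lambda>i. \<psi> (- (V i / of_real R))) summable_on I"
      using summable_on_cong[OF eq, of I] by simp
    show "(\<Sum>\<^sub>\<infinity>i\<in>I. \<psi> (- (V i / of_real R))) = (\<Sum>\<^sub>\<infinity>i\<in>I. \<psi> (V i / of_real R))"
      using infsum_reindex_bij_betw[OF \<sigma>(1), of "\<lambda>i. \<psi> (V i / of_real R)"] infsum_cong[OF eq, of I] by simp
  qed
  have e_int: "integral\<^sup>L lborel ?e = integral\<^sup>L lborel \<psi>"
    using int integral_lborel_reflect[OF m] by simp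
  have e_sum: "(\<Sum>\<^sub>\<infinity>i\<in>I. ?e (V i / of_real R)) = (\<Sum>\<^sub>\<infinity>i\<in>I. \<psi> (V i / of_real R))" if "R > 0" for R
  proof -
    have "((\<lambda>i. ?e (V i / of_real R)) has_sum
        1 / 2 * ((\<Sum>\<^sub>\<infinity>i\<in>I. \<psi> (V i / of_real R)) + (\<Sum>\<^sub>\<infinity>i\<in>I. \<psi> (V i / of_real R)))) I"
      using has_sum_cmult_right[OF has_sum_add[OF has_sum_infsum[OF sum[OF that]] has_sum_infsum[OF reflect(1)[OF that]]], of "1 / 2"]
      unfolding reflect(2)[OF that] .
    then show ?thesis by (simp add: infsumI)
  qed
  have "\<forall>\<^sub>F R in at_top. (\<Sum>\<^sub>\<infinity>i\<in>I. ?e (V i / of_real R)) / R\<^sup>2 = (\<Sum>\<^sub>\<infinity>i\<in>I. \<psi> (V i / of_real R)) / R\<^sup>2"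
    using eventually_gt_at_top[of 0] by eventually_elim (simp only: e_sum)
  moreover have "((\<lambda>R. (\<Sum>\<^sub>\<infinity>i\<in>I. ?e (V i / of_real R)) / R\<^sup>2) \<longlongrightarrow> c * integral\<^sup>L lborel \<psi>) at_top"
    using e unfolding equidistributes_def e_int by blast
  ultimately have "((\<lambda>R. (\<Sum>\<^sub>\<infinity>i\<in>I. \<psi> (V i / of_real R)) / R\<^sup>2) \<longlongrightarrow> c * integral\<^sup>L lborel \<psi>) at_top"
    by (rule Lim_transform_eventually[rotated])
  then show ?thesis using int sum by (simp add: equidistributes_def)
qed

theorem compactly_supported_asymptotics:
  fixes \<psi> :: "complex \<Rightarrow> complex"
  assumes \<sigma>: "bij_betw \<sigma> I I" "\<And>i. i \<in> I \<Longrightarrow> V (\<sigma> i) = - V i"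
    and \<psi>: "continuous_on UNIV \<psi>" and supp: "compact (closure {u. \<psi> u \<noteq> 0})"
  shows "((\<lambda>R. (\<Sum>\<^sub>\<infinity>i\<in>I. \<psi> (V i / of_real R)) / of_real (R\<^sup>2)) \<longlongrightarrow> of_real c * (LINT u|lborel. \<psi> u)) at_top"
proof -
  have "bounded {u. \<psi> u \<noteq> 0}"
    using supp compact_imp_bounded bounded_subset closure_subset by blast
  then obtain B where "\<And>z. \<psi> z \<noteq> 0 \<Longrightarrow> cmod z \<le> B" by (auto simp: bounded_iff)
  then have B: "\<psi> z = 0" if "cmod z > B" for z using that by (meson not_le)
  have re: "equidistributes (\<lambda>z. Re (\<psi> z))" and im: "equidistributes (\<lambda>z. Im (\<psi> z))"
    by (rule equidistributes_real[OF \<sigma>, where B = B]; auto intro!: continuous_intros \<psi> simp: B)+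
  let ?S = "\<lambda>f R. (\<Sum>\<^sub>\<infinity>i\<in>I. f (V i / of_real R)) / R\<^sup>2"
  have "((\<lambda>R. of_real (?S (\<lambda>z. Re (\<psi> z)) R) + \<i> * of_real (?S (\<lambda>z. Im (\<psi> z)) R)) \<longlongrightarrow>
     of_real (c * (LINT z|lborel. Re (\<psi> z))) + \<i> * of_real (c * (LINT z|lborel. Im (\<psi> z)))) at_top"
    using re im unfolding equidistributes_def by (intro tendsto_intros) auto
  moreover have "of_real (c * (LINT z|lborel. Re (\<psi> z))) + \<i> * of_real (c * (LINT z|lborel. Im (\<psi> z))) =
      of_real c * (LINT u|lborel. \<psi> u)"
  proof -
    have "(LINT u|lborel. \<psi> u) = (LINT u|lborel. complex_of_real (Re (\<psi> u)) + \<i> * complex_of_real (Im (\<psi> u)))"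
      by (simp flip: complex_eq)
    also have "\<dots> = of_real (LINT u|lborel. Re (\<psi> u)) + \<i> * of_real (LINT u|lborel. Im (\<psi> u))"
      using re im by (subst Bochner_Integration.integral_add) (auto simp: equidistributes_def)
    finally show ?thesis by (simp add: distrib_left)
  qed
  moreover have "\<forall>\<^sub>F R in at_top. of_real (?S (\<lambda>z. Re (\<psi> z)) R) + \<i> * of_real (?S (\<lambda>z. Im (\<psi> z)) R) =
      (\<Sum>\<^sub>\<infinity>i\<in>I. \<psi> (V i / of_real R)) / of_real (R\<^sup>2)"
    using eventually_gt_at_top[of 0]
  proof eventually_elim
    case (elim R)
    have s: "(\<lambda>i. Re (\<psi> (V i / of_real R))) summable_on I" "(\<lambda>i. Im (\<psi> (V i / of_real R))) summable_on I"
      using re im elim by (auto simp: equidistributes_def)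
    have "((\<lambda>i. complex_of_real (Re (\<psi> (V i / of_real R))) + \<i> * complex_of_real (Im (\<psi> (V i / of_real R)))) has_sum
       (of_real (\<Sum>\<^sub>\<infinity>i\<in>I. Re (\<psi> (V i / of_real R))) + \<i> * of_real (\<Sum>\<^sub>\<infinity>i\<in>I. Im (\<psi> (V i / of_real R))))) I"
      using s by (intro has_sum_add has_sum_cmult_right has_sum_of_real has_sum_infsum)
    then have "(\<Sum>\<^sub>\<infinity>i\<in>I. \<psi> (V i / of_real R)) =
       of_real (\<Sum>\<^sub>\<infinity>i\<in>I. Re (\<psi> (V i / of_real R))) + \<i> * of_real (\<Sum>\<^sub>\<infinity>i\<in>I. Im (\<psi> (V i / of_real R)))"
      by (intro infsumI) (simp flip: complex_eq)
    then show ?case by (simp add: add_divide_distrib)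
  qed
  ultimately show ?thesis using Lim_transform_eventually by fastforce
qed

end

text \<open>
  An infinite count would make the quotient infinite from some \<open>R\<close> on, so a finite limit
  forces all counts to be finite, by monotonicity.
\<close>

lemma real_limit_of_ext_card_limit:
  assumes lim: "((\<lambda>R. ext_card {i \<in> I. f i < R} / ereal (R\<^sup>2)) \<longlongrightarrow> ereal L) at_top"
  shows "finite {i \<in> I. f i < R}"
    and "((\<lambda>R. real (card {i \<in> I. f i < R}) / R\<^sup>2) \<longlongrightarrow> L) at_top"
proof -
  have "\<forall>\<^sub>F R in at_top. ext_card {i \<in> I. f i < R} / ereal (R\<^sup>2) < \<infinity>"
    by (rule order_tendstoD(2)[OF lim]) simp
  then obtain R0 where R0: "\<And>R. R \<ge> R0 \<Longrightarrow> ext_card {i \<in> I. f i < R} / ereal (R\<^sup>2) < \<infinity>"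
    by (auto simp: eventually_at_top_linorder)
  show fin: "finite {i \<in> I. f i < R}" for R
  proof (rule finite_subset)
    define r where "r = max (max R R0) 1"
    have r: "r \<ge> R0" "r \<ge> R" "r > 0" by (auto simp: r_def)
    then show "{i \<in> I. f i < R} \<subseteq> {i \<in> I. f i < r}" by auto
    have "\<infinity> / ereal (r\<^sup>2) = \<infinity>" using r(3) by simp
    then show "finite {i \<in> I. f i < r}"
      using R0[OF r(1)] by (auto simp: ext_card_def split: if_splits)
  qed
  have "\<forall>\<^sub>F R in at_top. ext_card {i \<in> I. f i < R} / ereal (R\<^sup>2) = ereal (real (card {i \<in> I. f i < R}) / R\<^sup>2)"
    using eventually_gt_at_top[of 0] by eventually_elim (simp add: ext_card_def fin)
  from Lim_transform_eventually[OF lim this]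
  show "((\<lambda>R. real (card {i \<in> I. f i < R}) / R\<^sup>2) \<longlongrightarrow> L) at_top"
    by simp
qed

theorem theorem0p18:
  fixes S :: "'a quad_surface" and c :: real and \<psi> :: "complex \<Rightarrow> complex"
  assumes "closed_quad_surface S"
    and "lattice_SL2R (Lambda S)"
    and "\<And>g. g \<in> carrier SL2R \<Longrightarrow>
           ((\<lambda>R. N_count (act g S) R / ereal (R\<^sup>2)) \<longlongrightarrow> ereal (c * pi)) at_top"
    and "continuous_on UNIV \<psi>"
    and "compact (closure {u. \<psi> u \<noteq> 0})"
  shows "((\<lambda>R. (\<Sum>\<^sub>\<infinity>(C, v)\<in>Pi_vectors S. \<psi> (v / of_real R)) / of_real (R\<^sup>2))
           \<longlongrightarrow> of_real c * (LINT u|lborel. \<psi> u)) at_top"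
proof -
  have lim: "((\<lambda>R. ext_card {i \<in> Pi_vectors S. cmod (mat_act g (snd i)) < R} / ereal (R\<^sup>2)) \<longlongrightarrow> ereal (c * pi)) at_top"
    if "det g = 1" for g
    using assms(3)[of g] that by (simp add: SL2R_def N_count_act[OF assms(1)])
  interpret ellipse_asymptotics "Pi_vectors S" snd c
    by unfold_locales (use real_limit_of_ext_card_limit[OF lim] in blast)+
  let ?\<sigma> = "\<lambda>(C :: 'a set, v :: complex). (C, - v)"
  have "?\<sigma> i \<in> Pi_vectors S" if "i \<in> Pi_vectors S" for i
    using that by (cases i) (auto simp: Pi_vectors_iff[OF assms(1)])
  then have "bij_betw ?\<sigma> (Pi_vectors S) (Pi_vectors S)"
    by (intro bij_betw_byWitness[where f' = ?\<sigma>]) auto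
  from compactly_supported_asymptotics[OF this _ assms(4,5)]
  show ?thesis by (simp add: case_prod_unfold)
qed

end
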